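(* There exists a universal constant $\kappa\ge1$ such that the following holds. Let $n\ge2$, $1\le k\le n/2$, let $f\colon\{0,1\}^m\to\{0,1\}^n$ be a $d$-local function, define $\gamma=k/n$, and let $\theta>0$ be arbitrary (possibly depending on $n$). If $\theta\ge\kappa$, $$d\le\log^*(\theta)/60\quad\text{and}\quad\log^*(1/\gamma)\le\log^*(\theta)/2,$$ then $$\|f(\mathcal{U}^m)-\mathcal{D}_k\|\ge 1-\theta/\sqrt n.$$
   Context: $\mathcal{U}^m$ is uniform on $\{0,1\}^m$; $\mathcal{D}_k$ is the uniform distribution on strings in $\{0,1\}^n$ of Hamming weight $k$. A function $f$ is $d$-local if each output bit depends on at most $d$ input bits. $\log^*$ is the iterated base-2 logarithm: $\log^*(x)$ is the least $h\ge0$ with $\mathrm{tow}_2(h)\ge x$, where $\mathrm{tow}_2(0)=1$ and $\mathrm{tow}_2(h)=2^{\mathrm{tow}_2(h-1)}$. $\|\cdot\|$ is total variation distance. *)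

theory Defs
  imports "HOL-Probability.Probability"
begin

definition cube :: "nat \<Rightarrow> bool list set" where
  "cube m = {xs. length xs = m}"

definition unif_cube :: "nat \<Rightarrow> bool list pmf" where
  "unif_cube m = pmf_of_set (cube m)"

definition slice_dist :: "nat \<Rightarrow> nat \<Rightarrow> bool list pmf" where
  "slice_dist n k = pmf_of_set {ys \<in> cube n. count_list ys True = k}"

definition d_local :: "nat \<Rightarrow> nat \<Rightarrow> nat \<Rightarrow> (bool list \<Rightarrow> bool list) \<Rightarrow> bool" where
  "d_local m n d f \<longleftrightarrow>
     (\<forall>x \<in> cube m. f x \<in> cube n) \<and>
     (\<forall>i < n. \<exists>S. S \<subseteq> {..<m} \<and> card S \<le> d \<and>
        (\<forall>x \<in> cube m. \<forall>y \<in> cube m. (\<forall>j \<in> S. x ! j = y ! j) \<longrightarrow> f x ! i = f y ! i))"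

definition tvd :: "'a pmf \<Rightarrow> 'a pmf \<Rightarrow> real" where
  "tvd p q = (SUP A. \<bar>measure_pmf.prob p A - measure_pmf.prob q A\<bar>)"

fun tow2 :: "nat \<Rightarrow> nat" where
  "tow2 0 = 1"
| "tow2 (Suc h) = 2 ^ tow2 h"

definition log_star :: "real \<Rightarrow> nat" where
  "log_star x = (LEAST h. real (tow2 h) \<ge> x)"

end

(*
Fix all inputs of very large degree (t of them).  By pigeonhole on the degree scales, the cut-off
can be chosen so that among the remaining inputs there are r >> t output coordinates i whose blocks
B_i (all outputs sharing an input with i) are small and read pairwise disjoint sets of inputs.

For each assignment to the t fixed inputs and each i there is a dichotomy.  Either the restricted map
misses a pattern on B_i (it never outputs 0 on B_i, or never outputs 1 on B_i), or we can change the
inputs of i so that B_i goes from all-zero to not all-zero, which shifts the total Hamming weight by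
a positive amount not depending on the inputs outside the block.

If r/2 blocks miss a pattern, the output lies in a fixed set of exponentially small measure under
the slice distribution, small enough for a union bound over the 2^t assignments.  If r/2 blocks admit
a shift, the Hamming weight equals k with probability O(1/sqrt r).  So the event "weight different
from k, or output in one of the small sets" distinguishes the two distributions.
*)
theory Submission
  imports Defs
begin

text \<open>At most n d / \<open>D2\<close> inputs have degree above a cut-off \<open>D2\<close>.
  The union bound over their assignments needs far more than n d / \<open>D2\<close> blocks, by a
  factor beating \<gamma>^(-s) for blocks of size s. One cut-off cannot give this. Blocks have size
  s = 1 + d D when the free inputs of i have degree at most D, but blocks also collide through
  inputs of their other outputs; if those may have degree up to \<open>D2\<close>, only about n /
  \<open>D2\<close> disjoint blocks survive. Hence two nested pigeonholes. The coarse one finds D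
  with few edges of degree between D and M = 2^2^D. The fine one, inside that gap, finds
  \<open>D1\<close> and \<open>D2\<close> = K \<open>D1\<close> with so few edges between them that
  most blocks contain none, even after a loss of a factor s. About n / \<open>D1\<close> blocks
  remain, up to factors in d and s, and K beats D^s \<ge> \<gamma>^(-s). A coarse step costs two
  exponentials and up to 2 d + 1 steps are available, which is where the iterated logarithm and the
  linear bound on d come from. The all-zero pattern is one end of a switch because any other pattern
  on the block has larger weight, so the shift cannot vanish.\<close>

subsection \<open>Anticoncentration under independent switches\<close>

text \<open>The probability that a lazy random walk started at \<open>l\<close>, moving up or down with probability
  \<open>p\<close> each, has not hit \<open>0\<close> within \<open>r\<close> steps.\<close>

fun survival :: "real \<Rightarrow> nat \<Rightarrow> nat \<Rightarrow> real" where
  "survival p 0 l = (if l = 0 then 0 else 1)"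
| "survival p (Suc r) 0 = 0"
| "survival p (Suc r) (Suc l) =
     (1 - 2 * p) * survival p r (Suc l) + p * (survival p r l + survival p r (Suc (Suc l)))"

lemma survival_0 [simp]: "survival p r 0 = 0"
  by (cases r) auto

text \<open>One step of the walk maps the negated second difference at a point to a nonnegative
  combination of those at the point and its two neighbours. At the boundary the neighbour centred at
  0 drops out because the walk is killed there.\<close>

lemma survival_concave:
  assumes "0 \<le> p" "p \<le> 1/2"
  shows "survival p r l + survival p r (Suc (Suc l)) \<le> 2 * survival p r (Suc l)"
proof (induction r arbitrary: l)
  case (Suc r)
  let ?\<psi> = "survival p r"
  have 1: "(1 - 2*p) * (2 * ?\<psi> (Suc l) - ?\<psi> l - ?\<psi> (Suc (Suc l))) \<ge> 0" for l
    using Suc[of l] assms by simp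
  have 2: "p * (2 * ?\<psi> (Suc l) - ?\<psi> l - ?\<psi> (Suc (Suc l))) \<ge> 0" for l
    using Suc[of l] assms by simp
  show ?case
  proof (cases l)
    case 0
    then show ?thesis using 1[of 0] 2[of 1] by (simp add: algebra_simps)
  next
    case (Suc k)
    then show ?thesis using 1[of l] 2[of k] 2[of "Suc l"] by (simp add: algebra_simps)
  qed
qed auto

text \<open>Concavity: moving two points symmetrically apart lowers the sum, so unit displacement is
  the worst case. This replaces arbitrary integer shifts by nearest-neighbour steps.\<close>

lemma survival_spread:
  assumes "0 \<le> p" "p \<le> 1/2" "1 \<le> u" "u \<le> l"
  shows "survival p r (l + u) + survival p r (l - u) \<le> survival p r (l + 1) + survival p r (l - 1)"
proof -
  let ?\<psi> = "survival p r"
  have decr: "?\<psi> (Suc b) - ?\<psi> b \<le> ?\<psi> (Suc a) - ?\<psi> a" if "a \<le> b" for a b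
    using that
  proof (induction b rule: dec_induct)
    case (step b)
    then show ?case using survival_concave[OF assms(1,2), of r b] by linarith
  qed auto
  show ?thesis
    using assms(3,4)
  proof (induction u rule: dec_induct)
    case (step u)
    have "?\<psi> (Suc (l + u)) - ?\<psi> (l + u) \<le> ?\<psi> (Suc (l - Suc u)) - ?\<psi> (l - Suc u)"
      by (rule decr) auto
    moreover have "Suc (l - Suc u) = l - u" using step by simp
    ultimately show ?case using step by simp
  qed auto
qed

lemma survival_Suc_le:
  assumes "0 \<le> p" "p \<le> 1/2"
  shows "survival p (Suc r) l \<le> survival p r l"
proof (cases l)
  case (Suc k)
  have "p * (2 * survival p r (Suc k) - survival p r k - survival p r (Suc (Suc k))) \<ge> 0"
    using survival_concave[OF assms, of r k] assms by simp
  then show ?thesis using Suc by (simp add: algebra_simps)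
qed auto

lemma survival_antimono:
  assumes "0 \<le> p" "p \<le> 1/2" "r \<le> r'"
  shows "survival p r' l \<le> survival p r l"
  using assms(3)
proof (induction r' rule: dec_induct)
  case (step r')
  then show ?case using survival_Suc_le[OF assms(1,2), of r' l] by linarith
qed auto

text \<open>The expected time to leave \<open>[0, L]\<close> is \<open>l (L - l) / (2 p)\<close>, and the walk reaches \<open>L\<close> before \<open>0\<close>
  with probability \<open>l / L\<close>.\<close>

lemma sum_survival_le:
  assumes "0 < p" "p \<le> 1/2" "0 < L" "l \<le> L"
  shows "(\<Sum>t<r. survival p t l) \<le> r * (l / L) + l * (real L - l) / (2 * p)"
  using assms(4)
proof (induction r arbitrary: l)
  case (Suc r)
  have S: "(\<Sum>t<Suc r. survival p t l) = survival p 0 l + (\<Sum>t<r. survival p (Suc t) l)"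
    by (rule sum.lessThan_Suc_shift)
  consider "l = 0" | "l = L" | k where "l = Suc k" "l < L"
    using Suc.prems by (cases l) (auto simp: le_less)
  then show ?case
  proof cases
    case 2
    have "survival p t l \<le> 1" for t
      using survival_antimono[of p 0 t l] assms by (auto split: if_splits)
    then have "(\<Sum>t<Suc r. survival p t l) \<le> (\<Sum>t<Suc r. 1)"
      by (intro sum_mono) auto
    then show ?thesis using 2 assms(3) by simp
  next
    case 3
    let ?G = "\<lambda>l. (\<Sum>t<r. survival p t l)"
    have "(\<Sum>t<Suc r. survival p t l) = 1 + (1 - 2*p) * ?G (Suc k) + p * (?G k + ?G (Suc (Suc k)))"
      unfolding S using 3
      by (simp add: sum.distrib sum_distrib_left distrib_left)
    also have "\<dots> \<le> 1 + (1 - 2*p) * (r * (Suc k / L) + Suc k * (real L - Suc k) / (2 * p))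
        + p * ((r * (k / L) + k * (real L - k) / (2 * p)) 
              + (r * (Suc (Suc k) / L) + Suc (Suc k) * (real L - Suc (Suc k)) / (2 * p)))"
      by (intro add_mono mult_left_mono Suc.IH order.refl) (use 3 assms in auto)
    \<comment> \<open>One averaging step preserves the linear function l / L and lowers l (L - l) /
      (2 p) by exactly 1, which absorbs the leading summand 1.\<close>
    also have "\<dots> = r * (Suc k / L) + Suc k * (real L - Suc k) / (2 * p)"
      using assms by (simp add: field_simps) 
    also have "\<dots> \<le> Suc r * (Suc k / L) + Suc k * (real L - Suc k) / (2 * p)"
      by (intro add_mono mult_right_mono) auto
    finally show ?thesis using 3 by simp
  qed auto
qed (use assms in auto)

text \<open>Survival decreases in time, so its value at r is at most its average over earlier times.
  The level \<open>L\<close> stays free here and is balanced against r later.\<close>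

lemma survival_1_le:
  assumes "0 < p" "p \<le> 1/2" "0 < L" "0 < r"
  shows "survival p r 1 \<le> 1 / L + real L / (2 * p * r)"
proof -
  have "r * survival p r 1 = (\<Sum>t<r. survival p r 1)" by simp
  also have "\<dots> \<le> (\<Sum>t<r. survival p t 1)"
    by (intro sum_mono survival_antimono) (use assms in auto)
  also have "\<dots> \<le> r * (1 / L) + (real L - 1) / (2 * p)"
    using sum_survival_le[of p L 1 r] assms by simp
  also have "\<dots> \<le> r * (1 / L) + real L / (2 * p)"
    using assms by (intro add_mono divide_right_mono) auto
  finally show ?thesis using assms(1,3,4) by (simp add: field_simps)
qed

lemma sum_Pow_split:
  assumes "finite U" "I \<subseteq> U"
  shows "(\<Sum>X\<in>Pow U. h X) = (\<Sum>\<pi>\<in>Pow I. \<Sum>X\<in>Pow (U - I). h (X \<union> \<pi>))"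
  unfolding sum.cartesian_product
  by (rule sum.reindex_bij_witness[where i = "\<lambda>(\<pi>, X). X \<union> \<pi>" and j = "\<lambda>X. (X \<inter> I, X - I)"])
     (use assms in \<open>auto simp: Un_Int_distrib intro!: arg_cong[where f=h]\<close>)

text \<open>Conditioning on the inputs in \<open>I j\<close>, the two patterns \<open>\<alpha> j\<close> and \<open>\<beta> j\<close> contribute
  \<open>P(g \<in> C) + P(g \<in> C - a) = P(g \<in> C \<union> (C - a)) + P(g \<in> C \<inter> (C - a))\<close>, where the two target sets
  have sizes \<open>|C| + u\<close> and \<open>|C| - u\<close> with \<open>u \<ge> 1\<close>. By concavity this is one step of the walk
  started at \<open>|C|\<close>.\<close>

lemma sum_Pow_switch_le:
  fixes g :: "'a set \<Rightarrow> int"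
  assumes "finite J" "finite U"
    and "\<And>j. j \<in> J \<Longrightarrow> I j \<subseteq> U \<and> card (I j) \<le> e \<and> \<alpha> j \<subseteq> I j \<and> \<beta> j \<subseteq> I j \<and> a j > 0"
    and "disjoint_family_on I J"
    and "\<And>j X. j \<in> J \<Longrightarrow> X \<subseteq> U \<Longrightarrow> g (X - I j \<union> \<beta> j) = g (X - I j \<union> \<alpha> j) + a j"
    and "finite C" "1 \<le> e"
  shows "(\<Sum>X\<in>Pow U. of_bool (g X \<in> C)) \<le> 2 ^ card U * survival (1 / 2 ^ e) (card J) (card C)"
  using assms(1-6)
\<comment> \<open>All three vary: \<open>U\<close> loses the inputs in \<open>I j\<close>,
  \<open>g\<close> is restricted by a pattern on \<open>I j\<close>, and the target set is replaced
  by a union or an intersection with its translate.\<close>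
proof (induction J arbitrary: U g C rule: finite_induct)
  case empty
  show ?case
  proof (cases "C = {}")
    case False
    have "(\<Sum>X\<in>Pow U. of_bool (g X \<in> C)) \<le> (\<Sum>X\<in>Pow U. 1::real)"
      by (intro sum_mono) auto
    then show ?thesis using False empty by (simp add: card_Pow)
  qed simp
next
  case (insert j J)
  define p :: real where "p = 1 / 2 ^ e"
  have p: "0 < p" "p \<le> 1/2" using \<open>1 \<le> e\<close> self_le_power[of "2::real" e] by (auto simp: p_def field_simps)
  let ?\<psi> = "survival p (card J)"
  define U' where "U' = U - I j"
  define T where "T = (\<lambda>C \<pi>. \<Sum>X\<in>Pow U'. of_bool (g (X \<union> \<pi>) \<in> C) :: real)"
  note j = insert.prems(2)[of j, simplified]
  have fin: "finite U" "finite (I j)"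
    using insert.prems(1) j finite_subset[of "I j" U] by blast+
  have dis: "I i \<inter> I j = {}" if "i \<in> J" for i
    using insert.prems(3) that insert.hyps by (auto simp: disjoint_family_on_def)
  have IH: "T C' \<pi> \<le> 2 ^ card U' * ?\<psi> (card C')" if "\<pi> \<subseteq> I j" "finite C'" for C' \<pi>
    unfolding T_def p_def
  proof (rule insert.IH[of U' "\<lambda>X. g (X \<union> \<pi>)" C'])
    fix i assume i: "i \<in> J"
    show "I i \<subseteq> U' \<and> card (I i) \<le> e \<and> \<alpha> i \<subseteq> I i \<and> \<beta> i \<subseteq> I i \<and> 0 < a i"
      using insert.prems(2)[of i] dis[OF i] i by (auto simp: U'_def)
    fix X assume X: "X \<subseteq> U'"
    have "X - I i \<union> \<gamma> \<union> \<pi> = (X \<union> \<pi>) - I i \<union> \<gamma>" for \<gamma>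
      using dis[OF i] that by auto
    moreover have "X \<union> \<pi> \<subseteq> U" using X that j by (auto simp: U'_def)
    ultimately show "g (X - I i \<union> \<beta> i \<union> \<pi>) = g (X - I i \<union> \<alpha> i \<union> \<pi>) + a i"
      using insert.prems(4)[of i "X \<union> \<pi>"] i by simp
  next
    show "disjoint_family_on I J" using insert.prems(3) by (auto simp: disjoint_family_on_def)
  qed (use fin that in \<open>auto simp: U'_def\<close>)
  show ?case
  proof (cases "C = {}")
    case False
    define l where "l = card C"
    define C' where "C' = (\<lambda>x. x - a j) ` C"
    define u where "u = card (C \<union> C') - l"
    have finC: "finite C" "finite C'" using insert.prems by (auto simp: C'_def)
    have cC': "card C' = l" unfolding C'_def l_def by (rule card_image) (auto simp: inj_on_def)
    \<comment> \<open>Translating down by a positive amount produces an element below the minimum of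
      \<open>C\<close>, so the union is strictly larger and u is at least 1.\<close>
    have "Min C \<in> C" "Min C - a j \<in> C'" using finC False by (auto simp: C'_def)
    moreover have "Min C - a j \<notin> C" 
      using j Min_le[OF finC(1)] by force
    ultimately have "C \<subset> C \<union> C'" by auto
    then have u1: "1 \<le> u" "card (C \<union> C') = l + u"
      using psubset_card_mono[of "C \<union> C'" C] finC by (auto simp: u_def l_def)
    have ui: "card (C \<inter> C') = l - u" "u \<le> l"
      using card_Un_Int[OF finC] cC' u1 by (auto simp: l_def)
    have gab: "g (X \<union> \<beta> j) = g (X \<union> \<alpha> j) + a j" if "X \<subseteq> U'" for X
    proof -
      have "X - I j = X" "X \<subseteq> U" using that by (auto simp: U'_def)
      then show ?thesis using insert.prems(4)[of j X] by simp
    qed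
    have "T C (\<alpha> j) + T C (\<beta> j) = T C (\<alpha> j) + T C' (\<alpha> j)"
      unfolding T_def by (intro arg_cong2[where f="(+)"] refl sum.cong) 
        (auto simp: gab C'_def image_iff intro!: bexI[of _ "_ + _"])
    also have "\<dots> = T (C \<union> C') (\<alpha> j) + T (C \<inter> C') (\<alpha> j)"
      unfolding T_def sum.distrib[symmetric] by (intro sum.cong) auto
    also have "\<dots> \<le> 2 ^ card U' * ?\<psi> (l + u) + 2 ^ card U' * ?\<psi> (l - u)"
      using IH[of "\<alpha> j" "C \<union> C'"] IH[of "\<alpha> j" "C \<inter> C'"] j finC u1 ui by auto
    also have "\<dots> = 2 ^ card U' * (?\<psi> (l + u) + ?\<psi> (l - u))" by (simp add: algebra_simps)
    also have "\<dots> \<le> 2 ^ card U' * (?\<psi> (l + 1) + ?\<psi> (l - 1))"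
      using survival_spread[of p u l "card J"] p u1 ui by (intro mult_left_mono) auto
    finally have ab: "T C (\<alpha> j) + T C (\<beta> j) \<le> 2 ^ card U' * (?\<psi> (l + 1) + ?\<psi> (l - 1))" .
    have neq: "\<alpha> j \<noteq> \<beta> j" using gab[of "{}"] j by auto
    have rest: "(\<Sum>\<pi>\<in>Pow (I j) - {\<alpha> j, \<beta> j}. T C \<pi>) \<le> (2 ^ card (I j) - 2) * (2 ^ card U' * ?\<psi> l)"
    proof -
      have "card (Pow (I j) - {\<alpha> j, \<beta> j}) = 2 ^ card (I j) - 2"
        using j neq fin by (subst card_Diff_subset) (auto simp: card_Pow)
      moreover have "2 \<le> card (Pow (I j))"
        using card_mono[of "Pow (I j)" "{\<alpha> j, \<beta> j}"] j neq fin by auto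
      ultimately have "real (card (Pow (I j) - {\<alpha> j, \<beta> j})) = 2 ^ card (I j) - 2"
        using fin by (simp add: card_Pow of_nat_diff)
      then show ?thesis
        using sum_bounded_above[of "Pow (I j) - {\<alpha> j, \<beta> j}" "T C" "2 ^ card U' * ?\<psi> l"] IH finC
        by (auto simp: l_def)
    qed
    have "(\<Sum>X\<in>Pow U. of_bool (g X \<in> C)) = (\<Sum>\<pi>\<in>Pow (I j). T C \<pi>)"
      unfolding T_def U'_def using fin j by (intro sum_Pow_split) auto
    also have "\<dots> = (\<Sum>\<pi>\<in>Pow (I j) - {\<alpha> j, \<beta> j}. T C \<pi>) + (\<Sum>\<pi>\<in>{\<alpha> j, \<beta> j}. T C \<pi>)"
      using fin j by (intro sum.subset_diff) auto
    also have "(\<Sum>\<pi>\<in>{\<alpha> j, \<beta> j}. T C \<pi>) = T C (\<alpha> j) + T C (\<beta> j)" using neq by simp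
    also have "(\<Sum>\<pi>\<in>Pow (I j) - {\<alpha> j, \<beta> j}. T C \<pi>) + (T C (\<alpha> j) + T C (\<beta> j))
        \<le> (2 ^ card (I j) - 2) * (2 ^ card U' * ?\<psi> l) + 2 ^ card U' * (?\<psi> (l + 1) + ?\<psi> (l - 1))"
      using rest ab by linarith
    also have "\<dots> = 2 ^ card U' * (2 ^ card (I j) * ?\<psi> l - (2 * ?\<psi> l - ?\<psi> (l + 1) - ?\<psi> (l - 1)))"
      by (simp add: algebra_simps)
    \<comment> \<open>With fewer than \<open>e\<close> inputs in \<open>I j\<close>, each of the two
      patterns is more likely than \<open>p\<close>. The subtracted second difference is nonnegative
      by concavity, so scaling it down to the uniform rate \<open>p\<close> keeps an upper
      bound.\<close>
    also have "\<dots> \<le> 2 ^ card U' * (2 ^ card (I j) * ?\<psi> l - 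
        2 ^ card (I j) * p * (2 * ?\<psi> l - ?\<psi> (l + 1) - ?\<psi> (l - 1)))"
    proof -
      have "2 ^ card (I j) * p \<le> 1" using j by (simp add: p_def)
      moreover have "0 \<le> 2 * ?\<psi> l - ?\<psi> (l + 1) - ?\<psi> (l - 1)"
        using survival_concave[of p "card J" "l - 1"] p u1 ui by simp
      ultimately show ?thesis 
        by (intro mult_left_mono diff_mono order.refl mult_left_le_one_le) (use p in auto)
    qed
    also have "\<dots> = 2 ^ (card U' + card (I j)) * 
        (?\<psi> l - p * (2 * ?\<psi> l - ?\<psi> (l + 1) - ?\<psi> (l - 1)))"
      by (simp add: algebra_simps power_add)
    also have "card U' + card (I j) = card U"
      using fin j by (simp add: U'_def card_Diff_subset card_mono)
    also have "?\<psi> l - p * (2 * ?\<psi> l - ?\<psi> (l + 1) - ?\<psi> (l - 1)) = survival p (Suc (card J)) l"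
      using u1 ui by (cases l) (auto simp: algebra_simps)
    finally show ?thesis using insert.hyps by (simp add: p_def l_def)
  qed simp
qed

text \<open>A Littlewood-Offord bound for unequal shifts: a single target value starts the walk at
  1. For fixed \<open>e\<close> and \<open>L\<close> of order sqrt R the bound has order 1 / sqrt
  R.\<close>

lemma card_switch_le:
  fixes g :: "'a set \<Rightarrow> int" and L R :: nat
  assumes "finite J" "finite U"
    and "\<And>j. j \<in> J \<Longrightarrow> I j \<subseteq> U \<and> card (I j) \<le> e \<and> \<alpha> j \<subseteq> I j \<and> \<beta> j \<subseteq> I j \<and> a j > 0"
    and "disjoint_family_on I J"
    and "\<And>j X. j \<in> J \<Longrightarrow> X \<subseteq> U \<Longrightarrow> g (X - I j \<union> \<beta> j) = g (X - I j \<union> \<alpha> j) + a j"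
    and "1 \<le> e" "0 < L" "0 < R" "R \<le> card J"
  shows "real (card {X \<in> Pow U. g X = c}) \<le> 2 ^ card U * (1 / L + real L * 2 ^ e / (2 * real R))"
proof -
  have p: "0 < 1 / (2::real) ^ e" "1 / 2 ^ e \<le> (1/2::real)"
    using \<open>1 \<le> e\<close> self_le_power[of "2::real" e] by (auto simp: field_simps)
  have "real (card {X \<in> Pow U. g X = c}) = (\<Sum>X\<in>Pow U. of_bool (g X \<in> {c}))"
    using assms(2) by (simp add: of_bool_def sum.If_cases Int_def)
  also have "\<dots> \<le> 2 ^ card U * survival (1 / 2 ^ e) (card J) (card {c})"
    by (rule sum_Pow_switch_le[OF assms(1-5)]) (use assms in auto)
  also have "\<dots> \<le> 2 ^ card U * survival (1 / 2 ^ e) R 1"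
    using survival_antimono[of "1 / 2 ^ e" R "card J" 1] p assms by (intro mult_left_mono) auto
  also have "\<dots> \<le> 2 ^ card U * (1 / L + L / (2 * (1 / 2 ^ e) * R))"
    using survival_1_le[of "1 / 2 ^ e" L R] p assms by (intro mult_left_mono) auto
  finally show ?thesis by simp
qed

subsection \<open>Avoiding patterns on the slice\<close>

lemma sum_biased_Pow:
  fixes \<gamma> :: real
  assumes "finite U"
  shows "(\<Sum>Y\<in>Pow U. \<gamma> ^ card Y * (1 - \<gamma>) ^ card (U - Y)) = 1"
  using prod_add[OF assms, of "\<lambda>_. \<gamma>" "\<lambda>_. 1 - \<gamma>"] by simp

text \<open>Under the product measure with density \<gamma>, disjoint blocks are independent. Each
  prescribed pattern has probability at least \<gamma>^s, since \<gamma> \<le> 1 - \<gamma> and a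
  block has at most \<open>s\<close> elements.\<close>

lemma sum_biased_avoid_le:
  fixes \<gamma> :: real
  assumes "0 \<le> \<gamma>" "\<gamma> \<le> 1/2" "finite J" "finite U"
    and "\<And>j. j \<in> J \<Longrightarrow> B j \<subseteq> U \<and> card (B j) \<le> s \<and> Z j \<subseteq> B j"
    and "disjoint_family_on B J"
  shows "(\<Sum>Y\<in>Pow U. of_bool (\<forall>j\<in>J. Y \<inter> B j \<noteq> Z j) * (\<gamma> ^ card Y * (1 - \<gamma>) ^ card (U - Y)))
         \<le> (1 - \<gamma> ^ s) ^ card J"
  using assms(3-6)
proof (induction J arbitrary: U rule: finite_induct)
  case empty
  then show ?case using sum_biased_Pow[of U \<gamma>] by simp
next
  case (insert j J)
  let ?w = "\<lambda>U Y. \<gamma> ^ card Y * (1 - \<gamma>) ^ card (U - Y)"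
  let ?P = "\<lambda>Y. \<forall>j\<in>J. Y \<inter> B j \<noteq> Z j"
  note j = insert.prems(2)[of j, simplified]
  have fin: "finite U" "finite (B j)"
    using insert.prems(1) j finite_subset[of "B j" U] by blast+
  have dis: "B i \<inter> B j = {}" if "i \<in> J" for i
    using insert.prems(3) that insert.hyps by (auto simp: disjoint_family_on_def)
  have IH: "(\<Sum>Y\<in>Pow (U - B j). of_bool (?P Y) * ?w (U - B j) Y) \<le> (1 - \<gamma> ^ s) ^ card J"
  proof (rule insert.IH)
    fix i assume i: "i \<in> J"
    show "B i \<subseteq> U - B j \<and> card (B i) \<le> s \<and> Z i \<subseteq> B i"
      using insert.prems(2)[of i] dis[OF i] i by auto
  qed (use fin insert.prems in \<open>auto simp: disjoint_family_on_def\<close>)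
  have split: "of_bool (\<forall>i\<in>insert j J. (X \<union> \<pi>) \<inter> B i \<noteq> Z i) * ?w U (X \<union> \<pi>)
     = (of_bool (\<pi> \<noteq> Z j) * ?w (B j) \<pi>) * (of_bool (?P X) * ?w (U - B j) X)"
    if "\<pi> \<subseteq> B j" "X \<subseteq> U - B j" for X \<pi>
  proof -
    have "(X \<union> \<pi>) \<inter> B j = \<pi>" "\<And>i. i \<in> J \<Longrightarrow> (X \<union> \<pi>) \<inter> B i = X \<inter> B i"
      using that dis by auto
    then have 1: "(\<forall>i\<in>insert j J. (X \<union> \<pi>) \<inter> B i \<noteq> Z i) \<longleftrightarrow> \<pi> \<noteq> Z j \<and> ?P X" by auto
    have fX: "finite X" "finite \<pi>" using that fin finite_subset by blast+
    have 2: "card (X \<union> \<pi>) = card X + card \<pi>"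
      using that fX by (intro card_Un_disjoint) auto
    have "U - (X \<union> \<pi>) = (U - B j - X) \<union> (B j - \<pi>)" using that j by auto
    moreover have "card ((U - B j - X) \<union> (B j - \<pi>)) = card (U - B j - X) + card (B j - \<pi>)"
      using fin by (intro card_Un_disjoint) auto
    ultimately have 3: "card (U - (X \<union> \<pi>)) = card (U - B j - X) + card (B j - \<pi>)" by simp
    show ?thesis unfolding 1 2 3 by (simp add: power_add algebra_simps)
  qed
  have "(\<Sum>Y\<in>Pow U. of_bool (\<forall>i\<in>insert j J. Y \<inter> B i \<noteq> Z i) * ?w U Y)
     = (\<Sum>\<pi>\<in>Pow (B j). \<Sum>X\<in>Pow (U - B j). 
          of_bool (\<forall>i\<in>insert j J. (X \<union> \<pi>) \<inter> B i \<noteq> Z i) * ?w U (X \<union> \<pi>))"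
    by (rule sum_Pow_split) (use j fin in auto)
  also have "\<dots> = (\<Sum>\<pi>\<in>Pow (B j). \<Sum>X\<in>Pow (U - B j). 
      (of_bool (\<pi> \<noteq> Z j) * ?w (B j) \<pi>) * (of_bool (?P X) * ?w (U - B j) X))"
    by (intro sum.cong refl split) auto
  also have "\<dots> = (\<Sum>\<pi>\<in>Pow (B j). of_bool (\<pi> \<noteq> Z j) * ?w (B j) \<pi>) *
      (\<Sum>X\<in>Pow (U - B j). of_bool (?P X) * ?w (U - B j) X)"
    by (simp only: sum_product)
  also have "\<dots> \<le> (1 - \<gamma> ^ s) * (1 - \<gamma> ^ s) ^ card J"
  proof (rule mult_mono[OF _ IH])
    have "(\<Sum>\<pi>\<in>Pow (B j). of_bool (\<pi> \<noteq> Z j) * ?w (B j) \<pi>) =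
        (\<Sum>\<pi>\<in>Pow (B j). ?w (B j) \<pi> - (if \<pi> = Z j then ?w (B j) (Z j) else 0))"
      by (intro sum.cong) auto
    also have "\<dots> = 1 - ?w (B j) (Z j)"
      using fin j sum_biased_Pow[OF fin(2), of \<gamma>] by (simp add: sum_subtractf)
    also have "?w (B j) (Z j) \<ge> \<gamma> ^ card (Z j) * \<gamma> ^ card (B j - Z j)"
      using assms(1,2) by (intro mult_left_mono power_mono) auto
    moreover have "card (Z j) + card (B j - Z j) = card (B j)"
      using fin j card_Un_disjoint[of "Z j" "B j - Z j"]
      by (metis Diff_disjoint Diff_partition finite_Diff finite_subset)
    moreover have "\<gamma> ^ card (B j) \<ge> \<gamma> ^ s"
      using assms(1,2) j by (intro power_decreasing) auto
    ultimately show "(\<Sum>\<pi>\<in>Pow (B j). of_bool (\<pi> \<noteq> Z j) * ?w (B j) \<pi>) \<le> 1 - \<gamma> ^ s"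
      by (simp add: power_add[symmetric])
    show "0 \<le> 1 - \<gamma> ^ s" using assms(1,2) by (simp add: power_le_one)
    show "0 \<le> (\<Sum>X\<in>Pow (U - B j). of_bool (?P X) * ?w (U - B j) X)"
      using assms(1,2) by (intro sum_nonneg mult_nonneg_nonneg) auto
  qed
  finally show ?case using insert.hyps by simp
qed

text \<open>The n + 1 binomial probabilities sum to 1 and the one at the mean k is the largest, so
  it is at least their average.\<close>

lemma binomial_mode:
  assumes "k \<le> n" "0 < n"
  defines "\<gamma> \<equiv> real k / real n"
  shows "1 \<le> (real n + 1) * (real (n choose k) * \<gamma> ^ k * (1 - \<gamma>) ^ (n - k))"
proof -
  have \<gamma>: "0 \<le> \<gamma>" "\<gamma> \<le> 1" "n * \<gamma> = k" using assms by (auto simp: \<gamma>_def)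
  define b where "b j = real (n choose j) * \<gamma> ^ j * (1 - \<gamma>) ^ (n - j)" for j
  \<comment> \<open>The ratio of consecutive terms, cross-multiplied; comparing the two factors
    shows that the terms rise up to k and fall afterwards.\<close>
  have rec: "real (Suc j) * (1 - \<gamma>) * b (Suc j) = real (n - j) * \<gamma> * b j" if "j < n" for j
  proof -
    have "Suc j * (n choose Suc j) = (n - j) * (n choose j)"
      by (simp only: binomial_absorption binomial_absorb_comp)
    then have 1: "real (Suc j) * real (n choose Suc j) = real (n - j) * real (n choose j)"
      by (metis of_nat_mult)
    have "n - j = Suc (n - Suc j)" using that by simp
    then have 2: "(1 - \<gamma>) ^ (n - j) = (1 - \<gamma>) * (1 - \<gamma>) ^ (n - Suc j)"
      by (simp only: power_Suc)
    have "real (Suc j) * (1 - \<gamma>) * b (Suc j) =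
        (real (Suc j) * real (n choose Suc j)) * \<gamma> * \<gamma> ^ j * ((1 - \<gamma>) * (1 - \<gamma>) ^ (n - Suc j))"
      by (simp only: b_def power_Suc mult_ac)
    also have "\<dots> = real (n - j) * \<gamma> * b j"
      unfolding 1 2[symmetric] by (simp only: b_def mult_ac)
    finally show ?thesis .
  qed
  have b0: "b j \<ge> 0" for j using \<gamma> by (simp add: b_def)
  show ?thesis
  \<comment> \<open>In these cases \<gamma> is 0 or 1, the factors to be cancelled may vanish, and
    all mass sits at k.\<close>
  proof (cases "k = n \<or> k = 0")
    case True
    then show ?thesis using assms by (auto simp: \<gamma>_def)
  next
    case False
    then have \<gamma>1: "0 < \<gamma>" "\<gamma> < 1" "0 < k" "k < n" using assms by (auto simp: \<gamma>_def)
    have up: "b j \<le> b (Suc j)" if "j < k" for j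
    proof -
      have "real (Suc j) \<le> real k" using that by simp
      then have "real (Suc j) * (1 - \<gamma>) \<le> real (n - j) * \<gamma>"
        using \<gamma> \<gamma>1 that by (simp add: of_nat_diff algebra_simps)
      then have "real (Suc j) * (1 - \<gamma>) * b j \<le> real (Suc j) * (1 - \<gamma>) * b (Suc j)"
        using rec[of j] that \<gamma>1 b0[of j] mult_right_mono by fastforce
      then show ?thesis using \<gamma>1 by (simp add: mult_le_cancel_left_pos)
    qed
    have down: "b (Suc j) \<le> b j" if "k \<le> j" "j < n" for j
    proof -
      have "real k \<le> real j" using that by simp
      then have le: "real (n - j) * \<gamma> \<le> real (Suc j) * (1 - \<gamma>)"
        using \<gamma> \<gamma>1 that by (simp add: of_nat_diff algebra_simps)
      have "real (Suc j) * (1 - \<gamma>) * b (Suc j) \<le> real (Suc j) * (1 - \<gamma>) * b j"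
        using rec[of j] that mult_right_mono[OF le b0[of j]] by simp
      then show ?thesis using \<gamma>1 by (simp add: mult_le_cancel_left_pos)
    qed
    have "b j \<le> b k" if "j \<le> n" for j
    proof (cases "j \<le> k")
      case True
      then show ?thesis
      proof (induction j rule: inc_induct)
        case (step i) then show ?case using up[of i] by simp
      qed auto
    next
      case False
      then have "k \<le> j" by simp
      then show ?thesis using that
      proof (induction j rule: dec_induct)
        case (step i) then show ?case using down[of i] by simp
      qed auto
    qed
    then have "(\<Sum>j\<le>n. b j) \<le> (\<Sum>j\<le>n. b k)" by (intro sum_mono) auto
    moreover have "(\<Sum>j\<le>n. b j) = 1"
      using binomial_ring[of \<gamma> "1 - \<gamma>" n] by (simp add: b_def)
    ultimately show ?thesis by (simp add: b_def add.commute)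
  qed
qed

text \<open>The product measure with density \<open>k / n\<close> is constant on the slice and gives it mass at least
  \<open>1 / (n + 1)\<close>.\<close>

lemma card_slice_avoid_le:
  fixes U :: "'a set" and B :: "'b \<Rightarrow> 'a set"
  assumes "finite U" "card U = n" "0 < n" "2 * k \<le> n"
    and "finite J" "\<And>j. j \<in> J \<Longrightarrow> B j \<subseteq> U \<and> card (B j) \<le> s \<and> Z j \<subseteq> B j"
    and "disjoint_family_on B J"
  shows "real (card {Y \<in> Pow U. card Y = k \<and> (\<forall>j\<in>J. Y \<inter> B j \<noteq> Z j)})
     \<le> real (n choose k) * ((real n + 1) * (1 - (real k / real n) ^ s) ^ card J)"
proof -
  define \<gamma> where "\<gamma> = real k / real n"
  have \<gamma>: "0 \<le> \<gamma>" "\<gamma> \<le> 1/2" using assms(3,4) by (auto simp: \<gamma>_def field_simps)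
  define W where "W = {Y \<in> Pow U. card Y = k \<and> (\<forall>j\<in>J. Y \<inter> B j \<noteq> Z j)}"
  define q where "q = \<gamma> ^ k * (1 - \<gamma>) ^ (n - k)"
  let ?h = "\<lambda>Y. of_bool (\<forall>j\<in>J. Y \<inter> B j \<noteq> Z j) * (\<gamma> ^ card Y * (1 - \<gamma>) ^ card (U - Y))"
  have "card W * q = (\<Sum>Y\<in>W. ?h Y)"
  proof -
    have "?h Y = q" if "Y \<in> W" for Y
      using that assms(1,2) finite_subset[of Y U]
      by (auto simp: W_def q_def card_Diff_subset)
    then show ?thesis by simp
  qed
  also have "\<dots> \<le> (\<Sum>Y\<in>Pow U. ?h Y)"
    using assms(1) \<gamma> by (intro sum_mono2) (auto simp: W_def)
  also have "\<dots> \<le> (1 - \<gamma> ^ s) ^ card J"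
    by (rule sum_biased_avoid_le) (use assms \<gamma> in auto)
  finally have 1: "card W * q \<le> (1 - \<gamma> ^ s) ^ card J" .
  have 2: "1 \<le> (real n + 1) * real (n choose k) * q"
    using binomial_mode[of k n] assms(3,4) by (simp add: q_def \<gamma>_def mult.assoc)
  have "real (card W) * 1 \<le> real (card W) * ((real n + 1) * real (n choose k) * q)"
    using 2 by (intro mult_left_mono) auto
  also have "\<dots> = (real n + 1) * real (n choose k) * (card W * q)" by simp
  also have "\<dots> \<le> (real n + 1) * real (n choose k) * (1 - \<gamma> ^ s) ^ card J"
    using 1 by (intro mult_left_mono) auto
  finally show ?thesis by (simp add: W_def \<gamma>_def mult_ac)
qed

subsection \<open>Isolated blocks in a bipartite graph\<close>

text \<open>\<open>V\<close> holds the output coordinates and \<open>N i\<close> the inputs read by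
  output i. Only the output side has bounded degree; an input may influence arbitrarily many
  outputs.\<close>

locale bounded_bipartite =
  fixes V :: "'v set" and N :: "'v \<Rightarrow> 'a set" and d :: nat
  assumes finite_V: "finite V"
    and finite_N: "\<And>i. i \<in> V \<Longrightarrow> finite (N i)"
    and card_N: "\<And>i. i \<in> V \<Longrightarrow> card (N i) \<le> d"
begin

definition outdeg :: "'a \<Rightarrow> nat" where
  "outdeg a = card {i \<in> V. a \<in> N i}"

text \<open>Edges are counted rather than inputs: bands over disjoint degree ranges share the at
  most n d edges, and each edge spoils only one output.\<close>

definition band :: "nat \<Rightarrow> nat \<Rightarrow> ('v \<times> 'a) set" where
  "band l u = {(i, a) \<in> Sigma V N. l < outdeg a \<and> outdeg a \<le> u}"

text \<open>The inputs of i that stay free once every input of degree above \<open>D\<close> is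
  fixed.\<close>

definition low :: "nat \<Rightarrow> 'v \<Rightarrow> 'a set" where
  "low D i = {a \<in> N i. outdeg a \<le> D}"

text \<open>The outputs that can react to the free inputs of i. The disjunct j = i keeps i in its
  own block even if all its inputs are fixed.\<close>

definition block :: "nat \<Rightarrow> 'v \<Rightarrow> 'v set" where
  "block D i = {j \<in> V. j = i \<or> low D i \<inter> N j \<noteq> {}}"

text \<open>With the high-degree inputs fixed, these determine all outputs in the block, so their
  disjointness is what makes blocks independent.\<close>

definition block_inputs :: "nat \<Rightarrow> 'v \<Rightarrow> 'a set" where
  "block_inputs D i = (\<Union>j\<in>block D i. low D j)"

lemma finite_edges: "finite (Sigma V N)"
  using finite_V finite_N by auto

lemma card_edges: "card (Sigma V N) \<le> card V * d"
  using finite_V finite_N card_N sum_bounded_above[of V "\<lambda>i. card (N i)" d] by simp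

lemma finite_band: "finite (band l u)"
  by (rule finite_subset[OF _ finite_edges]) (auto simp: band_def)

lemma finite_high_outdeg: "finite {a. u < outdeg a}"
  and card_high_outdeg: "card {a. u < outdeg a} * u \<le> card V * d"
proof -
  let ?S = "{a. u < outdeg a}"
  have sub: "?S \<subseteq> (\<Union>i\<in>V. N i)"
  proof
    fix a assume "a \<in> ?S"
    then have "0 < card {i \<in> V. a \<in> N i}" by (simp add: outdeg_def)
    then have "{i \<in> V. a \<in> N i} \<noteq> {}" by (metis card.empty less_irrefl)
    then show "a \<in> (\<Union>i\<in>V. N i)" by auto
  qed
  then show fin: "finite ?S" using finite_V finite_N by (meson finite_UN_I finite_subset)
  have "card ?S * u \<le> (\<Sum>a\<in>?S. outdeg a)"
    using sum_bounded_below[of ?S u outdeg] by auto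
  also have "\<dots> = (\<Sum>i\<in>V. card {a \<in> ?S. a \<in> N i})"
    by (rule sum_multicount_gen[symmetric]) (use fin finite_V in \<open>auto simp: outdeg_def\<close>)
  also have "\<dots> \<le> (\<Sum>i\<in>V. card (N i))"
    by (intro sum_mono card_mono) (use finite_N in auto)
  also have "\<dots> \<le> card V * d"
    using card_N sum_bounded_above[of V "\<lambda>i. card (N i)" d] by simp
  finally show "card ?S * u \<le> card V * d" .
qed

text \<open>Pigeonhole: \<open>L\<close> disjoint bands share at most n d edges. It is applied once
  to a tower scale and once to a geometric scale inside the gap found first.\<close>

lemma sparse_band_exists:
  assumes "mono T" "0 < L"
  shows "\<exists>l<L. L * card (band (T l) (T (Suc l))) \<le> card V * d"
proof (rule ccontr)
  assume "\<not> ?thesis"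
  then have gt: "card V * d < L * card (band (T l) (T (Suc l)))" if "l < L" for l
    using that by force
  have disj: "band (T l) (T (Suc l)) \<inter> band (T l') (T (Suc l')) = {}" if "l < l'" for l l'
    using monoD[OF assms(1), of "Suc l" l'] that by (auto simp: band_def)
  have "(\<Sum>l<L. card (band (T l) (T (Suc l)))) = card (\<Union>l<L. band (T l) (T (Suc l)))"
  proof (rule card_UN_disjoint[symmetric])
    show "\<forall>i\<in>{..<L}. \<forall>j\<in>{..<L}. i \<noteq> j \<longrightarrow> 
        band (T i) (T (Suc i)) \<inter> band (T j) (T (Suc j)) = {}"
      using disj by (metis Int_commute nat_neq_iff)
  qed (auto simp: finite_band)
  also have "\<dots> \<le> card (Sigma V N)"
    by (intro card_mono finite_edges) (auto simp: band_def)
  also note card_edges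
  finally have "(\<Sum>l<L. L * card (band (T l) (T (Suc l)))) \<le> L * (card V * d)"
    by (simp add: sum_distrib_left[symmetric])
  moreover have "(\<Sum>l<L. card V * d) < (\<Sum>l<L. L * card (band (T l) (T (Suc l))))"
    using gt assms(2) by (intro sum_strict_mono) auto
  ultimately show False by simp
qed

text \<open>Avoiding the band from \<open>D0\<close> to \<open>D2\<close> makes the free inputs of i
  have degree at most \<open>D0\<close>, which bounds the block by \<open>s\<close>. Avoiding the
  band from \<open>D1\<close> to \<open>D2\<close> at every output of the block caps all block
  inputs at degree \<open>D1\<close>. Each block then meets at most d s \<open>D1\<close> s others,
  and a maximal conflict-free family is large.\<close>

lemma exists_isolated_blocks:
  assumes "D0 \<le> D1" "D1 \<le> D2"
    and s: "s = 1 + d * D0"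
    and band02: "2 * card (band D0 D2) \<le> card V"
    and band12: "4 * s * card (band D1 D2) \<le> card V"
  obtains J where "J \<subseteq> V" "card V \<le> 4 * (card J * (1 + d * s * D1 * s))"
    "\<And>i. i \<in> J \<Longrightarrow> card (block D2 i) \<le> s"
    "\<And>i. i \<in> J \<Longrightarrow> card (block_inputs D2 i) \<le> d * s"
    "disjoint_family_on (block D2) J" "disjoint_family_on (block_inputs D2) J"
proof -
  have fin_blk [simp]: "finite (block D i)" for D i
    using finite_V by (auto simp: block_def)
  have fin_low: "finite (low D i)" and card_low: "card (low D i) \<le> d" if "i \<in> V" for D i
    using finite_N[OF that] card_N[OF that] card_mono[of "N i" "low D i"]
    by (auto simp: low_def)
  have fin_touch: "finite {j \<in> V. a \<in> N j}" for a using finite_V by auto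
  define good1 where "good1 = {i \<in> V. \<forall>a\<in>N i. \<not> (D0 < outdeg a \<and> outdeg a \<le> D2)}"
  define P where "P = {j \<in> V. \<exists>a\<in>N j. D1 < outdeg a \<and> outdeg a \<le> D2}"
  define good where "good = {i \<in> good1. block D2 i \<inter> P = {}}"
  have finP: "finite P" using finite_V by (auto simp: P_def)
  have fing: "finite good1" "finite good" using finite_V by (auto simp: good1_def good_def)
  have low_good: "outdeg a \<le> D0" if "i \<in> good1" "a \<in> low D2 i" for i a
    using that by (auto simp: good1_def low_def)
  have card_nb: "card {j \<in> V. A \<inter> N j \<noteq> {}} \<le> d * D" 
    if "finite A" "card A \<le> d" "\<And>a. a \<in> A \<Longrightarrow> outdeg a \<le> D" for A D
  proof -
    have "card {j \<in> V. A \<inter> N j \<noteq> {}} \<le> card (\<Union>a\<in>A. {j \<in> V. a \<in> N j})"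
      by (rule card_mono) (use that fin_touch in auto)
    also have "\<dots> \<le> (\<Sum>a\<in>A. card {j \<in> V. a \<in> N j})" by (rule card_UN_le) (use that in auto)
    also have "\<dots> \<le> card A * D"
      using sum_bounded_above[of A outdeg D] that by (auto simp: outdeg_def)
    also have "\<dots> \<le> d * D" using that by auto
    finally show ?thesis .
  qed
  have card_blk: "card (block D2 i) \<le> s" if "i \<in> good1" for i
  proof -
    have iV: "i \<in> V" using that by (auto simp: good1_def)
    have "card (block D2 i) \<le> card (insert i {j \<in> V. low D2 i \<inter> N j \<noteq> {}})"
      by (rule card_mono) (use finite_V in \<open>auto simp: block_def\<close>)
    also have "\<dots> \<le> Suc (card {j \<in> V. low D2 i \<inter> N j \<noteq> {}})"
      by (rule card_insert_le_m1) auto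
    also have "\<dots> \<le> s"
      using card_nb[OF fin_low[OF iV] card_low[OF iV] low_good[OF that]] s by simp
    finally show ?thesis .
  qed
  \<comment> \<open>The same count run backwards: for i in \<open>good1\<close>, a free input shared
    by i and j has degree at most \<open>D0\<close>. Hence one output in \<open>P\<close> spoils at
    most \<open>s\<close> blocks, which explains the factor \<open>s\<close> in
    \<open>band12\<close>.\<close>
  have card_rev: "card {i \<in> good1. j \<in> block D2 i} \<le> s" if "j \<in> V" for j
  proof -
    let ?A = "{a \<in> N j. outdeg a \<le> D0}"
    have "finite ?A" "card ?A \<le> d"
      using fin_low[OF that, of D0] card_low[OF that, of D0] by (auto simp: low_def)
    note nb = card_nb[OF this]
    have "card {i \<in> good1. j \<in> block D2 i} \<le> card (insert j {i \<in> V. ?A \<inter> N i \<noteq> {}})"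
    proof (rule card_mono)
      show "{i \<in> good1. j \<in> block D2 i} \<subseteq> insert j {i \<in> V. ?A \<inter> N i \<noteq> {}}"
      proof
        fix i assume "i \<in> {i \<in> good1. j \<in> block D2 i}"
        then have i: "i \<in> good1" "i \<in> V" and "j = i \<or> low D2 i \<inter> N j \<noteq> {}"
          by (auto simp: block_def good1_def)
        from this(3) show "i \<in> insert j {i \<in> V. ?A \<inter> N i \<noteq> {}}"
        proof
          assume "low D2 i \<inter> N j \<noteq> {}"
          then obtain a where a: "a \<in> low D2 i" "a \<in> N j" by auto
          then have "a \<in> ?A \<inter> N i" using low_good[OF i(1), of a] by (auto simp: low_def)
          then show ?thesis using i by auto
        qed auto
      qed
    qed (use finite_V in auto)
    also have "\<dots> \<le> Suc (card {i \<in> V. ?A \<inter> N i \<noteq> {}})"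
      by (rule card_insert_le_m1) auto
    also have "\<dots> \<le> s" using nb[of D0] s by simp
    finally show ?thesis .
  qed
  have card_bad1: "card (V - good1) \<le> card (band D0 D2)"
  proof -
    have "V - good1 \<subseteq> fst ` band D0 D2"
      by (force simp: good1_def band_def image_iff)
    then show ?thesis by (meson finite_band card_image_le card_mono finite_imageI le_trans)
  qed
  have card_P: "card P \<le> card (band D1 D2)"
  proof -
    have "P \<subseteq> fst ` band D1 D2"
      by (force simp: P_def band_def image_iff)
    then show ?thesis by (meson finite_band card_image_le card_mono finite_imageI le_trans)
  qed
  have card_bad2: "card (good1 - good) \<le> card P * s"
  proof -
    have "card (good1 - good) \<le> card (\<Union>j\<in>P. {i \<in> good1. j \<in> block D2 i})"
      by (rule card_mono) (use finP fing in \<open>auto simp: good_def\<close>)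
    also have "\<dots> \<le> (\<Sum>j\<in>P. card {i \<in> good1. j \<in> block D2 i})"
      by (rule card_UN_le[OF finP])
    also have "\<dots> \<le> card P * s"
      using sum_bounded_above[of P "\<lambda>j. card {i \<in> good1. j \<in> block D2 i}" s] card_rev
      by (auto simp: P_def)
    finally show ?thesis .
  qed
  \<comment> \<open>At most half of \<open>V\<close> is lost to the first band and a quarter to the
    second.\<close>
  have card_good: "card V \<le> 4 * card good"
  proof -
    have "card V = card (V - good1) + card (good1 - good) + card good"
    proof -
      have "good1 \<subseteq> V" "good \<subseteq> good1" by (auto simp: good1_def good_def)
      then show ?thesis
        using finite_V fing card_mono[of V good1] card_mono[of good1 good]
        by (simp add: card_Diff_subset)
    qed
    moreover have "4 * (card P * s) \<le> card V"
    proof -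
      have "4 * s * card P \<le> 4 * s * card (band D1 D2)"
        by (rule mult_le_mono[OF order.refl card_P])
      moreover have "4 * (card P * s) = 4 * s * card P" by simp
      ultimately show ?thesis using band12 by linarith
    qed
    ultimately show ?thesis using card_bad1 card_bad2 band02 by linarith
  qed
  have I_deg: "outdeg a \<le> D1" if "i \<in> good" "a \<in> block_inputs D2 i" for i a
    using that by (force simp: good_def P_def block_inputs_def low_def block_def)
  have fin_I: "finite (block_inputs D2 i)" for i
    unfolding block_inputs_def using fin_low by (auto simp: block_def finite_V)
  have card_I: "card (block_inputs D2 i) \<le> d * s" if "i \<in> good" for i
  proof -
    have "card (block_inputs D2 i) \<le> (\<Sum>j\<in>block D2 i. card (low D2 j))"
      unfolding block_inputs_def by (rule card_UN_le) auto
    also have "\<dots> \<le> card (block D2 i) * d"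
      using sum_bounded_above[of "block D2 i" "\<lambda>j. card (low D2 j)" d] card_low
      by (auto simp: block_def)
    also have "\<dots> \<le> s * d"
      using card_blk that by (auto simp: good_def)
    finally show ?thesis by (simp add: mult.commute)
  qed
  define confl where "confl i = {i' \<in> good. i' = i \<or> block_inputs D2 i' \<inter> block_inputs D2 i \<noteq> {}}" for i
  have card_confl: "card (confl i) \<le> 1 + d * s * D1 * s" if "i \<in> good" for i
  proof -
    let ?X = "\<Union>a\<in>block_inputs D2 i. \<Union>j\<in>{j \<in> V. a \<in> N j}. {i' \<in> good1. j \<in> block D2 i'}"
    have finX: "finite ?X" using fin_I fin_touch fing by auto
    have "confl i \<subseteq> insert i ?X"
    proof
      fix i' assume i': "i' \<in> confl i"
      show "i' \<in> insert i ?X"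
      proof (cases "i' = i")
        case False
        with i' obtain a where "a \<in> block_inputs D2 i'" "a \<in> block_inputs D2 i" "i' \<in> good"
          by (auto simp: confl_def)
        then obtain j where "j \<in> block D2 i'" "a \<in> N j" 
          by (auto simp: block_inputs_def low_def)
        moreover from this have "j \<in> V" by (auto simp: block_def)
        ultimately show ?thesis using \<open>i' \<in> good\<close> \<open>a \<in> block_inputs D2 i\<close>
          by (auto simp: good_def)
      qed auto
    qed
    then have "card (confl i) \<le> card (insert i ?X)" by (rule card_mono[rotated]) (use finX in auto)
    also have "\<dots> \<le> Suc (card ?X)" by (rule card_insert_le_m1) auto
    also have "card ?X \<le> (\<Sum>a\<in>block_inputs D2 i. D1 * s)"
    proof (rule order.trans[OF card_UN_le[OF fin_I]], rule sum_mono)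
      fix a assume a: "a \<in> block_inputs D2 i"
      have "card (\<Union>j\<in>{j \<in> V. a \<in> N j}. {i' \<in> good1. j \<in> block D2 i'})
          \<le> (\<Sum>j\<in>{j \<in> V. a \<in> N j}. card {i' \<in> good1. j \<in> block D2 i'})"
        by (rule card_UN_le[OF fin_touch])
      also have "\<dots> \<le> card {j \<in> V. a \<in> N j} * s"
        using sum_bounded_above[of "{j \<in> V. a \<in> N j}" "\<lambda>j. card {i' \<in> good1. j \<in> block D2 i'}" s] 
          card_rev by auto
      also have "\<dots> \<le> D1 * s" using I_deg[OF that a] by (auto simp: outdeg_def)
      finally show "card (\<Union>j\<in>{j \<in> V. a \<in> N j}. {i' \<in> good1. j \<in> block D2 i'}) \<le> D1 * s" .
    qed
    also have "\<dots> \<le> d * s * (D1 * s)"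
      using card_I[OF that] by simp
    finally show ?thesis by (simp add: mult_ac)
  qed
  \<comment> \<open>A maximal family dominates: every good output conflicts with a member, so the
    bound on \<open>confl\<close> bounds the size of the family from below.\<close>
  define ok where "ok J \<longleftrightarrow> J \<subseteq> good \<and> disjoint_family_on (block_inputs D2) J" for J
  have "finite {J. ok J}" using fing by (auto simp: ok_def)
  moreover have "ok {}" by (auto simp: ok_def disjoint_family_on_def)
  ultimately obtain J where J: "ok J" and max: "\<And>J'. ok J' \<Longrightarrow> J \<subseteq> J' \<Longrightarrow> J' = J"
    using finite_has_maximal[of "{J. ok J}"] by (metis empty_iff mem_Collect_eq)
  have JG: "J \<subseteq> good" "finite J" using J fing finite_subset by (auto simp: ok_def)
  have cover: "good \<subseteq> (\<Union>i\<in>J. confl i)"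
  proof
    fix i assume i: "i \<in> good"
    show "i \<in> (\<Union>i\<in>J. confl i)"
    proof (rule ccontr)
      assume n: "i \<notin> (\<Union>i\<in>J. confl i)"
      then have "i \<notin> J" "\<And>j. j \<in> J \<Longrightarrow> block_inputs D2 i \<inter> block_inputs D2 j = {}"
        using i by (auto simp: confl_def)
      then have "ok (insert i J)"
        using J i by (auto simp: ok_def disjoint_family_on_def) 
      then show False using max[of "insert i J"] \<open>i \<notin> J\<close> by auto
    qed
  qed
  have "card good \<le> card (\<Union>i\<in>J. confl i)"
    by (rule card_mono[OF _ cover]) (use JG fing in \<open>auto simp: confl_def\<close>)
  also have "\<dots> \<le> (\<Sum>i\<in>J. card (confl i))" by (rule card_UN_le[OF JG(2)])
  also have "\<dots> \<le> card J * (1 + d * s * D1 * s)"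
    using sum_bounded_above[of J "\<lambda>i. card (confl i)" "1 + d * s * D1 * s"] card_confl JG by auto
  finally have cJ: "card good \<le> card J * (1 + d * s * D1 * s)" .
  \<comment> \<open>A shared output j differs from one of the two centres, so it reads a free input
    of that centre. This input would lie in both input sets, which are disjoint.\<close>
  have disjB: "block D2 i \<inter> block D2 i' = {}" if "i \<in> J" "i' \<in> J" "i \<noteq> i'" for i i'
  proof (rule ccontr)
    assume "block D2 i \<inter> block D2 i' \<noteq> {}"
    then obtain j where j: "j \<in> block D2 i" "j \<in> block D2 i'" by auto
    then have sub: "low D2 j \<subseteq> block_inputs D2 i \<inter> block_inputs D2 i'"
      by (auto simp: block_inputs_def)
    have "low D2 j \<noteq> {}"
      using j that(3) by (cases "j = i") (auto simp: block_def low_def)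
    moreover have "block_inputs D2 i \<inter> block_inputs D2 i' = {}"
      using J that by (simp add: ok_def disjoint_family_on_def)
    ultimately show False using sub by blast
  qed
  show ?thesis
  proof
    show "J \<subseteq> V" using JG by (auto simp: good_def good1_def)
    show "card V \<le> 4 * (card J * (1 + d * s * D1 * s))" using card_good cJ by linarith
    show "disjoint_family_on (block D2) J" using disjB by (auto simp: disjoint_family_on_def)
    show "disjoint_family_on (block_inputs D2) J" using J by (auto simp: ok_def)
  qed (use JG card_blk card_I in \<open>auto simp: good_def\<close>)
qed

end

subsection \<open>The dichotomy for local maps\<close>

text \<open>Bit strings are represented by their supports, so the Hamming weight of an output is
  \<open>card (F X)\<close>.\<close>

locale local_map = bounded_bipartite V N d for V :: "'v set" and N :: "'v \<Rightarrow> 'a set" and d +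
  fixes U :: "'a set" and F :: "'a set \<Rightarrow> 'v set"
  assumes finite_U: "finite U"
    and F_range: "\<And>X. X \<subseteq> U \<Longrightarrow> F X \<subseteq> V"
    and F_local: "\<And>i X X'. i \<in> V \<Longrightarrow> X \<subseteq> U \<Longrightarrow> X' \<subseteq> U \<Longrightarrow> X \<inter> N i = X' \<inter> N i \<Longrightarrow> i \<in> F X \<longleftrightarrow> i \<in> F X'"
begin

text \<open>Start from \<open>X0\<close>, where the block is all zero, and copy the values of
  \<open>X1\<close> on the free inputs of j only. Output j then sees \<open>X1\<close> and becomes
  1, while outputs outside the block read none of the changed inputs. The shift is the weight of the
  block after the change.\<close>

lemma switch_exists:
  assumes j: "j \<in> V" and S: "S = {a \<in> U. D < outdeg a}" and \<rho>: "\<rho> \<subseteq> S"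
    and X0: "X0 \<subseteq> U - S" "F (X0 \<union> \<rho>) \<inter> block D j = {}"
    and X1: "X1 \<subseteq> U - S" "F (X1 \<union> \<rho>) \<inter> block D j = block D j"
  shows "\<exists>\<alpha> \<beta> a. \<alpha> \<subseteq> block_inputs D j \<and> \<beta> \<subseteq> block_inputs D j \<and> (a::int) > 0 \<and>
    (\<forall>X\<subseteq>U - S. int (card (F ((X - block_inputs D j \<union> \<beta>) \<union> \<rho>)))
              = int (card (F ((X - block_inputs D j \<union> \<alpha>) \<union> \<rho>))) + a)"
proof -
  let ?B = "block D j" and ?I = "block_inputs D j" and ?v = "low D j"
  define Xc where "Xc = (X0 - ?v) \<union> (X1 \<inter> ?v)"
  \<comment> \<open>The patterns prescribe all block inputs, although they can differ only on
    \<open>low D j\<close>: the rest must be frozen for the block outputs, and hence the shift, to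
    be constant.\<close>
  define \<alpha> where "\<alpha> = X0 \<inter> ?I"
  define \<beta> where "\<beta> = Xc \<inter> ?I"
  define a where "a = int (card (F (Xc \<union> \<rho>) \<inter> ?B))"
  have jB: "j \<in> ?B" using j by (auto simp: block_def)
  have vI: "?v \<subseteq> ?I" using jB by (auto simp: block_inputs_def)
  have sub: "X0 \<union> \<rho> \<subseteq> U" "X1 \<union> \<rho> \<subseteq> U" "Xc \<union> \<rho> \<subseteq> U" "\<alpha> \<subseteq> U - S" "\<beta> \<subseteq> U - S"
    using X0(1) X1(1) \<rho> S by (auto simp: Xc_def \<alpha>_def \<beta>_def)
  have N_low: "X \<inter> N i \<subseteq> low D i" if "X \<subseteq> U - S" for X i
    using that by (auto simp: low_def S)
  have "j \<in> F (Xc \<union> \<rho>) \<longleftrightarrow> j \<in> F (X1 \<union> \<rho>)"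
  proof (rule F_local[OF j sub(3,2)])
    show "(Xc \<union> \<rho>) \<inter> N j = (X1 \<union> \<rho>) \<inter> N j"
      using N_low[OF X0(1), of j] N_low[OF X1(1), of j] by (auto simp: Xc_def)
  qed
  then have "j \<in> F (Xc \<union> \<rho>) \<inter> ?B" using X1(2) jB by blast
  moreover have "finite ?B" using finite_V by (auto simp: block_def)
  ultimately have a: "a > 0" by (auto simp: a_def card_gt_0_iff)
  have "int (card (F (X - ?I \<union> \<beta> \<union> \<rho>))) = int (card (F (X - ?I \<union> \<alpha> \<union> \<rho>))) + a"
    if X: "X \<subseteq> U - S" for X
  proof -
    let ?X\<alpha> = "X - ?I \<union> \<alpha> \<union> \<rho>" and ?X\<beta> = "X - ?I \<union> \<beta> \<union> \<rho>"
    have subX: "?X\<alpha> \<subseteq> U" "?X\<beta> \<subseteq> U" using X sub \<rho> S by auto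
    have Xc_low: "Xc \<subseteq> U - S" using X0(1) X1(1) by (auto simp: Xc_def)
    have out: "i \<in> F ?X\<beta> \<longleftrightarrow> i \<in> F ?X\<alpha>" if "i \<in> V" "i \<notin> ?B" for i
    proof (rule F_local[OF that(1) subX(2,1)])
      show "?X\<beta> \<inter> N i = ?X\<alpha> \<inter> N i"
        using that by (auto simp: block_def \<alpha>_def \<beta>_def Xc_def)
    qed
    have in\<alpha>: "i \<in> F ?X\<alpha> \<longleftrightarrow> i \<in> F (X0 \<union> \<rho>)" if "i \<in> ?B" for i
    proof (rule F_local)
      show "i \<in> V" using that by (auto simp: block_def)
      have "low D i \<subseteq> ?I" using that by (auto simp: block_inputs_def)
      then show "?X\<alpha> \<inter> N i = (X0 \<union> \<rho>) \<inter> N i"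
        using N_low[OF X, of i] N_low[OF X0(1), of i] by (auto simp: \<alpha>_def)
    qed (use subX sub in auto)
    have in\<beta>: "i \<in> F ?X\<beta> \<longleftrightarrow> i \<in> F (Xc \<union> \<rho>)" if "i \<in> ?B" for i
    proof (rule F_local)
      show "i \<in> V" using that by (auto simp: block_def)
      have "low D i \<subseteq> ?I" using that by (auto simp: block_inputs_def)
      then show "?X\<beta> \<inter> N i = (Xc \<union> \<rho>) \<inter> N i"
        using N_low[OF X, of i] N_low[OF Xc_low, of i] by (auto simp: \<beta>_def)
    qed (use subX sub in auto)
    have FV: "F ?X\<alpha> \<subseteq> V" "F ?X\<beta> \<subseteq> V" using F_range subX by auto
    then have fin: "finite (F ?X\<alpha>)" "finite (F ?X\<beta>)" using finite_V finite_subset by auto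
    have "F ?X\<alpha> \<inter> ?B = {}" using in\<alpha> X0(2) by auto
    moreover have "F ?X\<beta> = F ?X\<alpha> \<union> (F (Xc \<union> \<rho>) \<inter> ?B)"
      using FV out in\<beta> calculation by blast
    ultimately show ?thesis
      using fin unfolding a_def by (subst \<open>F ?X\<beta> = _\<close>, subst card_Un_disjoint) auto
  qed
  then show ?thesis using a by (intro exI[of _ \<alpha>] exI[of _ \<beta>] exI[of _ a]) (auto simp: \<alpha>_def \<beta>_def)
qed

lemma exists_distinguisher:
  fixes k n s e D L R :: nat
  assumes n: "n = card V" "0 < n" "2 * k \<le> n"
    and S: "S = {a \<in> U. D < outdeg a}"
    and N_U: "\<And>i. i \<in> V \<Longrightarrow> N i \<subseteq> U"
    and J: "J \<subseteq> V" "\<And>i. i \<in> J \<Longrightarrow> card (block D i) \<le> s"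
      "\<And>i. i \<in> J \<Longrightarrow> card (block_inputs D i) \<le> e"
      "disjoint_family_on (block D) J" "disjoint_family_on (block_inputs D) J"
    and R: "1 \<le> e" "0 < L" "0 < R" "2 * R \<le> card J + 1"
  obtains Bad where
    "real (card {Y \<in> Pow V. card Y = k \<and> Y \<in> Bad})
       \<le> real (n choose k) * (2 ^ card S * ((real n + 1) * (1 - (real k / real n) ^ s) ^ R))"
    "real (card {X \<in> Pow U. card (F X) = k \<and> F X \<notin> Bad})
       \<le> 2 ^ card U * (1 / L + real L * 2 ^ e / (2 * real R))"
proof -
  have finS: "finite S" "S \<subseteq> U" using finite_U S by auto
  have finJ: "finite J" using J(1) finite_V finite_subset by auto
  \<comment> \<open>Any missing pattern serves the slice bound, so none is singled out here. If
    nothing is avoided, both the all-zero and the all-one pattern occur, as a switch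
    requires.\<close>
  define avoided where "avoided \<rho> j Z \<longleftrightarrow> Z \<subseteq> block D j \<and> (\<forall>X\<subseteq>U - S. F (X \<union> \<rho>) \<inter> block D j \<noteq> Z)" for \<rho> j Z
  define Jb where "Jb \<rho> = {j \<in> J. \<exists>Z. avoided \<rho> j Z}" for \<rho>
  define Z where "Z \<rho> j = (SOME Z. avoided \<rho> j Z)" for \<rho> j
  have Z: "avoided \<rho> j (Z \<rho> j)" if "j \<in> Jb \<rho>" for \<rho> j
    using that unfolding Jb_def Z_def by (intro someI_ex[of "avoided \<rho> j"]) simp
  define A where "A \<rho> = {Y \<in> Pow V. card Y = k \<and> (\<forall>j\<in>Jb \<rho>. Y \<inter> block D j \<noteq> Z \<rho> j)}" for \<rho>
  define type1 where "type1 = {\<rho> \<in> Pow S. R \<le> card (Jb \<rho>)}"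
  define Bad where "Bad = {Y. \<exists>\<rho>\<in>type1. \<forall>j\<in>Jb \<rho>. Y \<inter> block D j \<noteq> Z \<rho> j}"
  define \<gamma> where "\<gamma> = real k / real n"
  have \<gamma>: "0 \<le> \<gamma>" "\<gamma> \<le> 1" using n by (auto simp: \<gamma>_def)
  have Jb_sub: "Jb \<rho> \<subseteq> J" for \<rho> by (auto simp: Jb_def)
  have cardA: "real (card (A \<rho>)) \<le> real (n choose k) * ((real n + 1) * (1 - \<gamma> ^ s) ^ R)" 
    if "\<rho> \<in> type1" for \<rho>
  proof -
    have "real (card (A \<rho>)) \<le> real (n choose k) * ((real n + 1) * (1 - \<gamma> ^ s) ^ card (Jb \<rho>))"
      unfolding A_def \<gamma>_def
    proof (rule card_slice_avoid_le)
      fix j assume j: "j \<in> Jb \<rho>"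
      have "block D j \<subseteq> V" by (auto simp: block_def)
      then show "block D j \<subseteq> V \<and> card (block D j) \<le> s \<and> Z \<rho> j \<subseteq> block D j"
        using Z[OF j] J(2)[of j] Jb_sub[of \<rho>] j unfolding avoided_def by blast
    next
      show "finite (Jb \<rho>)" using finite_subset[OF Jb_sub finJ] .
      show "disjoint_family_on (block D) (Jb \<rho>)"
        using disjoint_family_on_mono[OF Jb_sub J(4)] .
    qed (use finite_V n in auto)
    also have "\<dots> \<le> real (n choose k) * ((real n + 1) * (1 - \<gamma> ^ s) ^ R)"
    proof -
      have "(1 - \<gamma> ^ s) ^ card (Jb \<rho>) \<le> (1 - \<gamma> ^ s) ^ R"
        using that power_le_one[OF \<gamma>, of s] \<gamma>(1) by (intro power_decreasing) (simp_all add: type1_def)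
      then show ?thesis by (intro mult_left_mono) simp_all
    qed
    finally show ?thesis .
  qed
  have finA: "finite (A \<rho>)" for \<rho> using finite_V by (auto simp: A_def)
  have type1: "type1 \<subseteq> Pow S" "finite type1" using finS by (auto simp: type1_def)
  show ?thesis
  proof
    have "real (card {Y \<in> Pow V. card Y = k \<and> Y \<in> Bad}) \<le> real (card (\<Union>\<rho>\<in>type1. A \<rho>))"
      unfolding of_nat_le_iff
      by (rule card_mono) (use type1 finA in \<open>auto simp: A_def Bad_def\<close>)
    also have "\<dots> \<le> real (\<Sum>\<rho>\<in>type1. card (A \<rho>))"
      unfolding of_nat_le_iff by (rule card_UN_le) (use type1 in auto)
    also have "\<dots> \<le> real (card type1) * (real (n choose k) * ((real n + 1) * (1 - \<gamma> ^ s) ^ R))"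
      using sum_bounded_above[of type1 "\<lambda>\<rho>. real (card (A \<rho>))", OF cardA] by simp
    also have "\<dots> \<le> 2 ^ card S * (real (n choose k) * ((real n + 1) * (1 - \<gamma> ^ s) ^ R))"
    proof (rule mult_right_mono)
      have "card type1 \<le> 2 ^ card S"
        using card_mono[OF _ type1(1)] finS by (simp add: card_Pow)
      then show "real (card type1) \<le> 2 ^ card S"
        by (metis of_nat_le_iff of_nat_numeral of_nat_power)
      show "0 \<le> real (n choose k) * ((real n + 1) * (1 - \<gamma> ^ s) ^ R)"
        using \<gamma> by (simp add: power_le_one)
    qed
    finally show "real (card {Y \<in> Pow V. card Y = k \<and> Y \<in> Bad})
       \<le> real (n choose k) * (2 ^ card S * ((real n + 1) * (1 - (real k / real n) ^ s) ^ R))"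
      by (simp only: \<gamma>_def mult.left_commute)
  next
    define bnd where "bnd = 2 ^ card (U - S) * (1 / L + real L * 2 ^ e / (2 * real R))"
    have bnd0: "0 \<le> bnd" by (simp add: bnd_def)
    define G where "G \<rho> = (\<Sum>X\<in>Pow (U - S). of_bool (card (F (X \<union> \<rho>)) = k \<and> F (X \<union> \<rho>) \<notin> Bad) :: real)" for \<rho>
    have G_le: "G \<rho> \<le> bnd" if \<rho>: "\<rho> \<subseteq> S" for \<rho>
    proof (cases "\<rho> \<in> type1")
      \<comment> \<open>For such a \<rho> every output misses the chosen pattern on each block in
        \<open>Jb\<close>, so it lies in \<open>Bad\<close> and costs nothing.\<close>
      case True
      have "F (X \<union> \<rho>) \<in> Bad" if "X \<subseteq> U - S" for X
        unfolding Bad_def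
      proof (intro CollectI bexI[OF _ True] ballI)
        fix j assume "j \<in> Jb \<rho>"
        then show "F (X \<union> \<rho>) \<inter> block D j \<noteq> Z \<rho> j"
          using Z[of j \<rho>] that by (simp add: avoided_def)
      qed
      then have "G \<rho> = 0" by (simp add: G_def)
      then show ?thesis using bnd0 by simp
    next
      case False
      define Ja where "Ja = J - Jb \<rho>"
      have "card Ja = card J - card (Jb \<rho>)"
        unfolding Ja_def by (intro card_Diff_subset finite_subset[OF Jb_sub finJ] Jb_sub)
      moreover have "card (Jb \<rho>) < R" using False \<rho> by (simp add: type1_def)
      \<comment> \<open>Fewer than R of at least 2 R - 1 blocks are removed.\<close>
      ultimately have cJa: "R \<le> card Ja" using R(4) by linarith
      define g where "g X = int (card (F (X \<union> \<rho>)))" for X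
      define switch where "switch j \<alpha> \<beta> a \<longleftrightarrow>
        \<alpha> \<subseteq> block_inputs D j \<and> \<beta> \<subseteq> block_inputs D j \<and> (a::int) > 0 \<and>
        (\<forall>X\<subseteq>U - S. g (X - block_inputs D j \<union> \<beta>) = g (X - block_inputs D j \<union> \<alpha>) + a)" for j \<alpha> \<beta> a
      have "\<forall>j\<in>Ja. \<exists>\<alpha> \<beta> a. switch j \<alpha> \<beta> a"
      proof
        fix j assume j: "j \<in> Ja"
        then have na: "\<not> avoided \<rho> j Z" for Z by (auto simp: Ja_def Jb_def)
        from na[of "{}"] obtain X0 where X0: "X0 \<subseteq> U - S" "F (X0 \<union> \<rho>) \<inter> block D j = {}"
          unfolding avoided_def by blast
        from na[of "block D j"] obtain X1 where X1: "X1 \<subseteq> U - S" "F (X1 \<union> \<rho>) \<inter> block D j = block D j"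
          unfolding avoided_def by blast
        have "j \<in> V" using j J(1) by (auto simp: Ja_def)
        from switch_exists[OF this S \<rho> X0 X1]
        show "\<exists>\<alpha> \<beta> a. switch j \<alpha> \<beta> a" unfolding switch_def g_def .
      qed
      then obtain \<alpha> \<beta> a where sw: "\<And>j. j \<in> Ja \<Longrightarrow> switch j (\<alpha> j) (\<beta> j) (a j)"
        by metis
      have IU: "block_inputs D j \<subseteq> U - S" for j
      proof
        fix a assume "a \<in> block_inputs D j"
        then obtain i where "i \<in> V" "a \<in> N i" "outdeg a \<le> D"
          by (auto simp: block_inputs_def block_def low_def)
        then show "a \<in> U - S" using N_U[of i] S by auto
      qed
      have "G \<rho> \<le> (\<Sum>X\<in>Pow (U - S). of_bool (g X = int k))"
        unfolding G_def by (intro sum_mono) (auto simp: g_def)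
      also have "\<dots> = real (card {X \<in> Pow (U - S). g X = int k})"
        using finite_U by (simp add: of_bool_def sum.If_cases Int_def)
      also have "\<dots> \<le> bnd"
        unfolding bnd_def
      proof (rule card_switch_le[of Ja _ "block_inputs D" e \<alpha> \<beta> a])
        show "finite Ja" "finite (U - S)" using finJ finite_U by (simp_all add: Ja_def)
        show "disjoint_family_on (block_inputs D) Ja"
          by (rule disjoint_family_on_mono[OF _ J(5)]) (simp add: Ja_def)
      next
        fix j assume j: "j \<in> Ja"
        then have "j \<in> J" by (simp add: Ja_def)
        then show "block_inputs D j \<subseteq> U - S \<and> card (block_inputs D j) \<le> e \<and>
            \<alpha> j \<subseteq> block_inputs D j \<and> \<beta> j \<subseteq> block_inputs D j \<and> 0 < a j"
          using sw[OF j] IU[of j] J(3)[of j] by (simp add: switch_def)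
      next
        fix j X assume "j \<in> Ja" "X \<subseteq> U - S"
        then show "g (X - block_inputs D j \<union> \<beta> j) = g (X - block_inputs D j \<union> \<alpha> j) + a j"
          using sw[of j] by (simp add: switch_def)
      qed (use R cJa in auto)
      finally show ?thesis .
    qed
    have "real (card {X \<in> Pow U. card (F X) = k \<and> F X \<notin> Bad})
        = (\<Sum>X\<in>Pow U. of_bool (card (F X) = k \<and> F X \<notin> Bad))"
      using finite_U by (simp add: of_bool_def sum.If_cases Int_def)
    also have "\<dots> = (\<Sum>\<rho>\<in>Pow S. G \<rho>)"
      unfolding G_def using finite_U finS by (intro sum_Pow_split) auto
    also have "\<dots> \<le> real (card (Pow S)) * bnd"
      by (rule sum_bounded_above) (use G_le in auto)
    also have "\<dots> = 2 ^ (card S + card (U - S)) * (1 / L + real L * 2 ^ e / (2 * real R))"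
      using finS by (simp add: card_Pow bnd_def power_add)
    also have "card S + card (U - S) = card U"
      using finS finite_U by (simp add: card_Diff_subset card_mono)
    finally show "real (card {X \<in> Pow U. card (F X) = k \<and> F X \<notin> Bad})
       \<le> 2 ^ card U * (1 / L + real L * 2 ^ e / (2 * real R))" .
  qed
qed

end

subsection \<open>Parameters\<close>

text \<open>The first bound lets one fine step, a factor 2^(D^4), beat the conflict factor times
  D^s. The second keeps all fine steps inside the gap up to 2^2^D, and the third keeps the number of
  patterns on a block below it. Everything is polynomial in D in the exponent, and D^9 suffices as a
  majorant.\<close>

lemma parameter_bounds:
  fixes D d s :: nat
  assumes D: "16 \<le> D" "D ^ 9 \<le> 2 ^ D" and d: "d \<le> D" and s: "s = 1 + d * D"
  shows "16 * (d + 1) * (1 + d * s * s) * D ^ s \<le> 2 ^ (D ^ 4)"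
    and "D * (2 ^ (D ^ 4)) ^ (4 * s * d + 1) \<le> 2 ^ 2 ^ D"
    and "(2::nat) ^ (d * s + 1) \<le> 2 ^ 2 ^ D"
proof -
  have mono: "D ^ a \<le> D ^ b" if "a \<le> b" for a b using that D by (intro power_increasing) auto
  have s2: "s \<le> 2 * D ^ 2"
  proof -
    have "d * D \<le> D ^ 2" using d by (simp add: power2_eq_square)
    moreover have "1 \<le> D ^ 2" using D by simp
    ultimately show ?thesis using s by linarith
  qed
  have ds: "d * s \<le> 2 * D ^ 3"
    using mult_le_mono[OF d s2] by (simp add: power2_eq_square power3_eq_cube)
  have dss: "d * s * s \<le> 4 * D ^ 5"
    using mult_le_mono[OF ds s2] by (simp add: power_add[symmetric])
  \<comment> \<open>Numerical constants are absorbed by one extra power of D, since D is at least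
    16.\<close>
  have scale: "c * D ^ a \<le> D ^ Suc a" if "c \<le> 16" for c a
    using that D by simp
  have "d + 1 \<le> 2 ^ D" "D \<le> 2 ^ D"
    using le_less_trans[OF d less_exp[of D]] less_exp[of D] by linarith+
  have c1: "1 + d * s * s \<le> D ^ 6"
  proof -
    have "1 \<le> D ^ 5" using D by simp
    then show ?thesis using dss scale[of 5 5] by simp
  qed
  have D6: "D ^ 6 \<le> 2 ^ (6 * D)"
    using power_mono[OF \<open>D \<le> 2 ^ D\<close>, of 6] by (simp add: power_mult[symmetric] mult.commute)
  have Ds: "D ^ s \<le> 2 ^ (2 * D ^ 3)"
  proof -
    have "D ^ s \<le> (2 ^ D) ^ s" by (rule power_mono[OF \<open>D \<le> 2 ^ D\<close>]) simp
    also have "\<dots> \<le> 2 ^ (D * (2 * D ^ 2))"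
      unfolding power_mult[symmetric] using s2 by (intro power_increasing mult_le_mono) auto
    also have "D * (2 * D ^ 2) = 2 * D ^ 3" by (simp add: power2_eq_square power3_eq_cube)
    finally show ?thesis .
  qed
  have "16 * (d + 1) * (1 + d * s * s) * D ^ s \<le> 2 ^ 4 * 2 ^ D * 2 ^ (6 * D) * 2 ^ (2 * D ^ 3)"
    using \<open>d + 1 \<le> 2 ^ D\<close> c1 D6 Ds by (intro mult_le_mono) auto
  also have "\<dots> = 2 ^ (4 + D + 6 * D + 2 * D ^ 3)" by (simp only: power_add)
  also have "\<dots> \<le> 2 ^ (D ^ 4)"
  proof (rule power_increasing)
    have "4 + D + 6 * D \<le> 16 * D" using D by simp
    also have "\<dots> \<le> D ^ 2" using D by (simp add: power2_eq_square)
    also have "\<dots> \<le> D ^ 3" by (rule mono) simp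
    finally show "4 + D + 6 * D + 2 * D ^ 3 \<le> D ^ 4"
      using scale[of 3 3] by simp
  qed auto
  finally show "16 * (d + 1) * (1 + d * s * s) * D ^ s \<le> 2 ^ (D ^ 4)" .
  have "4 * s * d + 1 \<le> D ^ 4"
  proof -
    have "1 \<le> D ^ 3" using D by simp
    then show ?thesis using ds scale[of 9 3] by (simp add: mult_ac)
  qed
  then have "D * (2 ^ (D ^ 4)) ^ (4 * s * d + 1) \<le> 2 ^ D * (2 ^ (D ^ 4)) ^ (D ^ 4)"
    using \<open>D \<le> 2 ^ D\<close> by (intro mult_le_mono power_increasing) auto
  also have "\<dots> = 2 ^ (D + D ^ 4 * D ^ 4)" by (simp only: power_add power_mult)
  also have "\<dots> \<le> 2 ^ 2 ^ D"
  proof (rule power_increasing)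
    have "D + D ^ 4 * D ^ 4 \<le> 2 * D ^ 8" using mono[of 1 8] by (simp add: power_add[symmetric])
    also have "\<dots> \<le> D ^ 9" using scale[of 2 8] by simp
    finally show "D + D ^ 4 * D ^ 4 \<le> 2 ^ D" using D by linarith
  qed auto
  finally show "D * (2 ^ (D ^ 4)) ^ (4 * s * d + 1) \<le> 2 ^ 2 ^ D" .
  have "d * s + 1 \<le> 2 ^ D"
  proof -
    have "1 \<le> D ^ 3" using D by simp
    then have "d * s + 1 \<le> D ^ 4" using ds scale[of 3 3] by simp
    also have "\<dots> \<le> D ^ 9" by (rule mono) simp
    finally show ?thesis using D by linarith
  qed
  then show "(2::nat) ^ (d * s + 1) \<le> 2 ^ 2 ^ D" by (intro power_increasing) auto
qed

text \<open>Here \<open>t\<close> counts the fixed inputs, \<open>W\<close> bounds the conflicts per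
  block, \<open>Q\<close> bounds \<gamma>^(-s), and \<open>M\<close> is the end of the coarse
  gap.\<close>

lemma error_terms_le:
  fixes n k d s e t R L D2 W Q M :: nat
  assumes n: "0 < n" "0 < k" "k \<le> n" "n \<le> k * D" and t: "t * D2 \<le> n * d"
    and R: "n \<le> 8 * (R * W)" and Q: "Q = D ^ s" and W: "0 < W" and D: "0 < D"
    and D2: "16 * (d + 1) * (W * Q) \<le> D2" "D2 \<le> M" and e: "2 ^ e \<le> M"
    and L: "sqrt n \<le> L" "L \<le> 2 * sqrt n"
  shows "2 ^ t * ((real n + 1) * (1 - (real k / real n) ^ s) ^ R) + (1 / L + real L * 2 ^ e / (2 * real R))
         \<le> 16 * real M ^ 2 / sqrt n"
proof -
  have pos: "0 < real W" "0 < real Q" "0 < real n" "0 < sqrt n" "1 \<le> real n" "0 < real D2"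
    using n W Q D D2 by (auto intro: Nat.gr0I)
  have R0: "0 < R" using R n by (cases R) auto
  have L0: "0 < real L" using L pos by linarith
  have M1: "1 \<le> real M" using D2(2) pos(6) by simp
  have Wle: "real W \<le> M"
  proof -
    have "W * 1 \<le> W * Q" using pos(2) by (intro mult_le_mono) auto
    also have "\<dots> \<le> 16 * (d + 1) * (W * Q)" by simp
    finally show ?thesis using D2 by linarith
  qed
  have Rn: "real n \<le> 8 * (real R * real W)" using R
    by (metis of_nat_le_iff of_nat_mult of_nat_numeral)
  have sq: "sqrt n * sqrt n = n" using pos by simp
  have sq_le: "1 / real n \<le> 1 / sqrt n" 
  proof (rule divide_left_mono)
    have "sqrt n * 1 \<le> sqrt n * sqrt n" using pos by (intro mult_left_mono) auto
    then show "sqrt n \<le> real n" using sq by simp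
  qed (use pos in auto)
  have term2: "1 / L \<le> 1 / sqrt n"
    using L pos L0 by (intro divide_left_mono mult_pos_pos) auto
  have e': "2 ^ e \<le> real M" using e by (metis of_nat_le_iff of_nat_numeral of_nat_power)
  have term3: "real L * 2 ^ e / (2 * real R) \<le> 8 * M ^ 2 / sqrt n"
  proof -
    have "real L * 2 ^ e / (2 * real R) \<le> (2 * sqrt n) * M / (2 * real R)"
      using L R0 e' by (intro divide_right_mono mult_mono) auto
    also have "\<dots> = sqrt n * M / R" by simp
    also have "1 / real R \<le> 8 * real W / n" using R0 Rn pos by (simp add: field_simps)
    then have "sqrt n * M / R \<le> sqrt n * M * (8 * real W / n)"
      using pos mult_left_mono[of "1 / real R" "8 * real W / n" "sqrt n * M"] by simp
    also have "\<dots> = 8 * M * W / sqrt n" 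
      using pos sq by (simp add: field_simps)
    also have "\<dots> \<le> 8 * M * M / sqrt n" using Wle pos by (intro divide_right_mono mult_left_mono) auto
    finally show ?thesis by (simp add: power2_eq_square)
  qed
  \<comment> \<open>A lower bound for R / Q. Fixing the high-degree inputs costs at most exp (x /
    2), half of the exponent gained from the avoided patterns.\<close>
  define x where "x = real n / (8 * W * Q)"
  have x0: "0 < x" using pos by (simp add: x_def)
  have q: "1 / real Q \<le> (real k / real n) ^ s"
  proof -
    have "real n \<le> real k * real D" using n(4) by (metis of_nat_le_iff of_nat_mult)
    then have "1 / real D \<le> real k / real n" using D pos by (simp add: field_simps)
    then have "(1 / real D) ^ s \<le> (real k / real n) ^ s" by (intro power_mono) auto
    then show ?thesis by (simp add: Q power_divide)
  qed
  have g1: "(real k / real n) ^ s \<le> 1" using n by (intro power_le_one) auto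
  have "(1 - (real k / real n) ^ s) ^ R \<le> (exp (- (1 / real Q))) ^ R"
    using q g1 exp_ge_add_one_self[of "- (1 / real Q)"] by (intro power_mono) auto
  also have "\<dots> = exp (- (R / Q))" by (simp add: exp_of_nat_mult[symmetric])
  also have "\<dots> \<le> exp (- x)"
    using Rn pos by (simp add: x_def field_simps)
  finally have e1: "(1 - (real k / real n) ^ s) ^ R \<le> exp (- x)" .
  have t_le: "real t \<le> x / 2"
  proof -
    have "real t * (16 * (real d + 1) * (real W * real Q)) \<le> real t * real D2"
    proof (rule mult_left_mono)
      have "real (16 * (d + 1) * (W * Q)) \<le> real D2" using D2(1) by (simp only: of_nat_le_iff)
      then show "16 * (real d + 1) * (real W * real Q) \<le> real D2" by (simp add: algebra_simps)
    qed simp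
    also have "\<dots> \<le> real n * real d" using t by (metis of_nat_le_iff of_nat_mult)
    also have "\<dots> \<le> real n * (real d + 1)" by (intro mult_left_mono) auto
    finally have "(16 * real t * (real W * real Q)) * (real d + 1) \<le> real n * (real d + 1)"
      by (simp add: mult_ac)
    then have "16 * real t * (real W * real Q) \<le> real n" by simp
    then show ?thesis using pos by (simp add: x_def field_simps)
  qed
  have "(2::real) ^ t \<le> exp 1 ^ t" using exp_ge_add_one_self[of 1] by (intro power_mono) auto
  also have "\<dots> = exp t" by (simp add: exp_of_nat_mult[symmetric])
  also have "\<dots> \<le> exp (x / 2)" using t_le by simp
  finally have "2 ^ t * (1 - (real k / real n) ^ s) ^ R \<le> exp (x / 2) * exp (- x)"
    using e1 g1 by (intro mult_mono) auto
  also have "\<dots> = exp (- (x / 2))" by (simp add: mult_exp_exp)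
  also have "\<dots> = 1 / exp (x / 2)" by (simp add: exp_minus inverse_eq_divide)
  \<comment> \<open>Quadratic decay is enough: against the factor n + 1 it leaves order 1 / n, below
    the 1 / sqrt n of the other terms.\<close>
  also have "\<dots> \<le> 1 / ((x / 2) ^ 2 / 2)"
    using exp_lower_Taylor_quadratic[of "x / 2"] x0 by (intro divide_left_mono) auto
  also have "\<dots> = 8 / x ^ 2" by (simp add: power2_eq_square)
  finally have "(real n + 1) * (2 ^ t * (1 - (real k / real n) ^ s) ^ R) \<le> (2 * n) * (8 / x ^ 2)"
    using pos by (intro mult_mono) (auto simp: g1)
  also have "\<dots> = 1024 * (W * Q) ^ 2 * (1 / n)"
    using pos by (simp add: x_def field_simps power2_eq_square)
  also have "\<dots> \<le> 1024 * (real W * real Q) ^ 2 * (1 / sqrt n)"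
    using sq_le by (simp add: mult_left_mono del: times_divide_eq_right)
  also have "\<dots> \<le> 4 * M ^ 2 * (1 / sqrt n)"
  proof -
    have "16 * (W * Q) \<le> 16 * (d + 1) * (W * Q)" by simp
    also have "\<dots> \<le> M" using D2 by linarith
    finally have "real (16 * (W * Q)) \<le> real M" by (simp only: of_nat_le_iff)
    then have "16 * (real W * real Q) \<le> M" by simp
    then have "(16 * (real W * real Q)) ^ 2 \<le> real M ^ 2" by (intro power_mono) auto
    then show ?thesis using pos by (intro mult_right_mono) (auto simp: power_mult_distrib mult_ac)
  qed
  finally have term1: "2 ^ t * ((real n + 1) * (1 - (real k / real n) ^ s) ^ R) \<le> 4 * M ^ 2 / sqrt n"
    by (simp add: mult_ac)
  have "1 \<le> real M ^ 2" using M1 by simp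
  then have "1 / sqrt n + 4 * M ^ 2 / sqrt n + 8 * M ^ 2 / sqrt n \<le> 16 * real M ^ 2 / sqrt n"
    unfolding add_divide_distrib[symmetric] using pos by (intro divide_right_mono) auto
  then show ?thesis using term1 term2 term3 by linarith
qed

section \<open>The tower function and the iterated logarithm\<close>

lemma less_tow2: "h < tow2 h"
proof (induction h)
  case (Suc h)
  have "Suc h < Suc (tow2 h)" using Suc by simp
  also have "\<dots> \<le> 2 ^ tow2 h" by (rule Suc_leI[OF less_exp])
  finally show ?case by simp
qed simp

lemma tow2_mono: "h \<le> h' \<Longrightarrow> tow2 h \<le> tow2 h'"
proof (induction h' rule: dec_induct)
  case (step h')
  then have "tow2 h \<le> 2 ^ tow2 h'" using less_exp[of "tow2 h'"] by linarith
  then show ?case by simp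
qed simp

lemma le_tow2_log_star: "x \<le> real (tow2 (log_star x))"
  unfolding log_star_def
proof (rule LeastI_ex)
  obtain h where "x \<le> real h" using real_arch_simple by blast
  then show "\<exists>h. x \<le> tow2 h" using less_tow2[of h] by (intro exI[of _ h]) simp
qed

lemma tow2_less_log_star: "h < log_star x \<Longrightarrow> real (tow2 h) < x"
  using not_less_Least[of h "\<lambda>h. x \<le> real (tow2 h)"] by (simp add: log_star_def)

text \<open>Writing \<open>tow2 h\<close> as 2^u, the claim is 9 u \<le> 2^u with u at least 16. At
  h = 3 it fails, as 16^9 exceeds 2^16.\<close>

lemma tow2_pow9_le:
  assumes "4 \<le> h"
  shows "16 \<le> tow2 h" "tow2 h ^ 9 \<le> 2 ^ tow2 h"
proof -
  have tow3: "tow2 3 = 16" by (simp add: numeral_3_eq_3)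
  obtain g where g: "h = Suc g" "3 \<le> g" using assms by (cases h) auto
  have u: "16 \<le> tow2 g" using tow2_mono[OF g(2)] tow3 by simp
  show "16 \<le> tow2 h" using tow2_mono[of 3 h] tow3 assms by simp
  have "9 * u \<le> 2 ^ u" if "16 \<le> u" for u :: nat
    using that by (induction u rule: dec_induct) auto
  from this[OF u] show "tow2 h ^ 9 \<le> 2 ^ tow2 h"
    by (simp add: g power_mult[symmetric] mult.commute)
qed

lemma less_log_star: "real (tow2 h) < x \<Longrightarrow> h < log_star x"
proof (rule ccontr)
  assume "real (tow2 h) < x" and "\<not> h < log_star x"
  then have "tow2 (log_star x) \<le> tow2 h" by (intro tow2_mono) simp
  then show False using le_tow2_log_star[of x] \<open>real (tow2 h) < x\<close> by linarith
qed

section \<open>Choice of the degree scales\<close>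

context local_map
begin

lemma exists_rare_outputs:
  fixes n k :: nat and \<theta> :: real
  assumes n: "n = card V" "0 < n" "0 < k" "2 * k \<le> n"
    and N_U: "\<And>i. i \<in> V \<Longrightarrow> N i \<subseteq> U"
    and \<theta>: "100 \<le> log_star \<theta>" "60 * d \<le> log_star \<theta>" "2 * log_star (n / k) \<le> log_star \<theta>"
  obtains Bad \<epsilon> \<delta> where
    "real (card {Y \<in> Pow V. card Y = k \<and> Y \<in> Bad}) \<le> real (n choose k) * \<epsilon>"
    "real (card {X \<in> Pow U. card (F X) = k \<and> F X \<notin> Bad}) \<le> 2 ^ card U * \<delta>"
    "\<epsilon> + \<delta> \<le> \<theta> / sqrt n"
proof -
  \<comment> \<open>With b d + 1 bands, the sparsest has at most n / b edges; the added 1 keeps the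
    number of bands positive when d = 0. It is used for b = 2 and b = 4 s.\<close>
  have sparse: "b * c \<le> n" if "(b * d + 1) * c \<le> n * d" for b c
  proof (cases "d = 0")
    case False
    have "d * (b * c) \<le> (b * d + 1) * c" by (simp add: algebra_simps)
    also have "\<dots> \<le> n * d" by (rule that)
    also have "n * d = d * n" by (rule mult.commute)
    finally show ?thesis using False by simp
  qed (use that in simp)
  \<comment> \<open>Half of the tower height makes \<open>tow2 h\<close> dominate both d and n / k;
    the other half pays for the coarse steps.\<close>
  define h where "h = log_star \<theta> div 2"
  \<comment> \<open>Two tower levels per step, so that consecutive scales are D and 2^2^D.\<close>
  define T where "T l = tow2 (h + 2 * l)" for l
  have "mono T" unfolding T_def by (intro monoI tow2_mono) simp
  then obtain l where l: "l < 2 * d + 1" and bandT: "(2 * d + 1) * card (band (T l) (T (Suc l))) \<le> n * d"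
    using sparse_band_exists[of T "2 * d + 1"] n by auto
  define D where "D = T l"
  define M where "M = T (Suc l)"
  have M: "M = 2 ^ 2 ^ D" by (simp add: M_def D_def T_def)
  have "4 \<le> h + 2 * l" "4 \<le> h + 2 * Suc l" using \<theta>(1) by (auto simp: h_def)
  then have D: "16 \<le> D" "D ^ 9 \<le> 2 ^ D" and M9: "16 \<le> M" "M ^ 9 \<le> 2 ^ M"
    using tow2_pow9_le[of "h + 2 * l"] tow2_pow9_le[of "h + 2 * Suc l"]
    unfolding D_def M_def T_def by blast+
  have hD: "tow2 h \<le> D" unfolding D_def T_def by (rule tow2_mono) simp
  have dD: "d \<le> D" using less_tow2[of h] hD \<theta>(1,2) by (simp add: h_def)
  have kD: "n \<le> k * D"
  proof -
    have "log_star (n / k) \<le> h" using \<theta>(3) by (simp add: h_def)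
    then have "tow2 (log_star (n / k)) \<le> D" using tow2_mono hD order.trans by blast
    then have "real n / real k \<le> D" using le_tow2_log_star[of "n / k"] by linarith
    then have "real n \<le> real (k * D)" using n by (simp add: field_simps)
    then show ?thesis by linarith
  qed
  define s where "s = 1 + d * D"
  define K :: nat where "K = 2 ^ (D ^ 4)"
  note pb = parameter_bounds[OF D dD s_def, folded K_def, folded M]
  define T' where "T' j = D * K ^ j" for j
  have "1 \<le> K" by (simp add: K_def)
  then have mT': "mono T'" unfolding T'_def by (intro monoI mult_le_mono power_increasing) auto
  then obtain j where j: "j < 4 * s * d + 1" and bandT': "(4 * s * d + 1) * card (band (T' j) (T' (Suc j))) \<le> n * d"
    using sparse_band_exists[of T' "4 * s * d + 1"] n by auto
  define D1 where "D1 = T' j"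
  define D2 where "D2 = T' (Suc j)"
  have D12: "D \<le> D1" "D1 \<le> D2" "D2 = K * D1"
    using monoD[OF mT', of 0 j] monoD[OF mT', of j "Suc j"] by (simp_all add: D1_def D2_def T'_def)
  have D2M: "D2 \<le> M"
  proof -
    have "D2 \<le> T' (4 * s * d + 1)" unfolding D2_def by (rule monoD[OF mT']) (use j in simp)
    also have "\<dots> \<le> M" unfolding T'_def by (rule pb(2))
    finally show ?thesis .
  qed
  have "card (band D D2) \<le> card (band D M)"
    using D2M by (intro card_mono finite_band) (auto simp: band_def)
  moreover have "2 * card (band D M) \<le> n" using sparse bandT by (simp add: D_def M_def)
  ultimately have band02: "2 * card (band D D2) \<le> card V" using n by linarith
  have band12: "4 * s * card (band D1 D2) \<le> card V"
    using sparse bandT' n by (simp add: D1_def D2_def)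
  obtain J where J: "J \<subseteq> V" "card V \<le> 4 * (card J * (1 + d * s * D1 * s))"
    "\<And>i. i \<in> J \<Longrightarrow> card (block D2 i) \<le> s"
    "\<And>i. i \<in> J \<Longrightarrow> card (block_inputs D2 i) \<le> d * s"
    "disjoint_family_on (block D2) J" "disjoint_family_on (block_inputs D2) J"
    using exists_isolated_blocks[OF D12(1,2) s_def band02 band12] by metis
  define W where "W = 1 + d * s * D1 * s"
  \<comment> \<open>Half of the blocks, rounded up, so that R is positive as soon as there is a
    block.\<close>
  define R where "R = (card J + 1) div 2"
  have R2: "2 * R \<le> card J + 1" "card J \<le> 2 * R" by (auto simp: R_def)
  have RW: "n \<le> 8 * (R * W)"
  proof -
    have "card J * W \<le> 2 * R * W" using R2 by (intro mult_le_mono) auto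
    moreover have "n \<le> 4 * (card J * W)" using J(2) n(1) by (simp only: W_def)
    moreover have "2 * R * W = 2 * (R * W)" by simp
    ultimately show ?thesis by linarith
  qed
  then have R0: "0 < R" using n by (intro Nat.gr0I) simp
  \<comment> \<open>R is n up to a factor bounded through M, so a walk level near sqrt n makes both
    terms of the switching bound O(M^2 / sqrt n).\<close>
  define L where "L = nat \<lceil>sqrt n\<rceil>"
  have s1: "1 \<le> sqrt n" using n by simp
  have L: "sqrt n \<le> L" "L \<le> 2 * sqrt n" using s1 unfolding L_def by linarith+
  have L0: "0 < L" using L s1 by linarith
  define S where "S = {a \<in> U. D2 < outdeg a}"
  have "card S \<le> card {a. D2 < outdeg a}"
    by (rule card_mono[OF finite_high_outdeg]) (auto simp: S_def)
  then have S: "card S * D2 \<le> n * d"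
    using card_high_outdeg[of D2] mult_le_mono1[of "card S" _ D2] n by (meson order.trans)
  \<comment> \<open>The added 1 keeps the exponent positive when d = 0.\<close>
  have J4: "card (block_inputs D2 i) \<le> d * s + 1" if "i \<in> J" for i using J(4)[OF that] by simp
  obtain Bad where Bad:
    "real (card {Y \<in> Pow V. card Y = k \<and> Y \<in> Bad})
       \<le> real (n choose k) * (2 ^ card S * ((real n + 1) * (1 - (real k / real n) ^ s) ^ R))"
    "real (card {X \<in> Pow U. card (F X) = k \<and> F X \<notin> Bad})
       \<le> 2 ^ card U * (1 / L + real L * 2 ^ (d * s + 1) / (2 * real R))"
    using exists_distinguisher[OF n(1,2,4) S_def N_U J(1,3) J4 J(5,6) _ L0 R0 R2(1)] by auto
  have WQ: "16 * (d + 1) * (W * D ^ s) \<le> D2"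
  proof -
    have "1 \<le> D1" using D D12 by simp
    then have "W \<le> (1 + d * s * s) * D1" unfolding W_def by (simp add: algebra_simps)
    then have "16 * (d + 1) * (W * D ^ s) \<le> 16 * (d + 1) * ((1 + d * s * s) * D1 * D ^ s)"
      by (intro mult_le_mono) auto
    also have "\<dots> = (16 * (d + 1) * (1 + d * s * s) * D ^ s) * D1" by (simp only: mult_ac)
    also have "\<dots> \<le> K * D1" using pb(1) by (rule mult_le_mono1)
    finally show ?thesis using D12(3) by simp
  qed
  have err: "2 ^ card S * ((real n + 1) * (1 - (real k / real n) ^ s) ^ R)
      + (1 / L + real L * 2 ^ (d * s + 1) / (2 * real R)) \<le> 16 * real M ^ 2 / sqrt n"
    by (rule error_terms_le[OF n(2,3) _ kD S RW refl _ _ WQ D2M pb(3) L]) 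
      (use n D in \<open>auto simp: W_def\<close>)
  \<comment> \<open>One more exponential dominates 16 M^2. Since l \<le> 2 d, the tower height
    reached is at most h + 4 d + 3, which is below \<open>log_star\<close> of \<theta>.\<close>
  have "16 * real M ^ 2 \<le> \<theta>"
  proof -
    have "16 * M ^ 2 \<le> M ^ 3" using M9 by (simp add: power2_eq_square power3_eq_cube)
    also have "\<dots> \<le> M ^ 9" using M9 by (intro power_increasing) auto
    also have "\<dots> \<le> 2 ^ M" by (rule M9)
    also have "\<dots> = tow2 (Suc (h + 2 * Suc l))" by (simp add: M_def T_def)
    finally have "real (16 * M ^ 2) \<le> real (tow2 (Suc (h + 2 * Suc l)))" by (simp only: of_nat_le_iff)
    also have "\<dots> < \<theta>"
      by (rule tow2_less_log_star) (use \<theta> l in \<open>simp add: h_def\<close>)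
    finally show ?thesis by simp
  qed
  then have "16 * real M ^ 2 / sqrt n \<le> \<theta> / sqrt n" by (intro divide_right_mono) auto
  then show ?thesis using that[OF Bad] err by linarith
qed

end

subsection \<open>Distance to the slice distribution\<close>

lemma tvd_ge: "measure_pmf.prob p A - measure_pmf.prob q A \<le> tvd p q"
proof -
  have "\<bar>measure_pmf.prob p B - measure_pmf.prob q B\<bar> \<le> 1" for B
    using measure_pmf.prob_le_1[of p B] measure_pmf.prob_le_1[of q B]
      measure_nonneg[of "measure_pmf p" B] measure_nonneg[of "measure_pmf q" B] by linarith
  then have "bdd_above (range (\<lambda>B. \<bar>measure_pmf.prob p B - measure_pmf.prob q B\<bar>))"
    by (intro bdd_aboveI[of _ 1]) auto
  then have "\<bar>measure_pmf.prob p A - measure_pmf.prob q A\<bar> \<le> tvd p q"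
    unfolding tvd_def by (rule cSUP_upper[OF UNIV_I])
  then show ?thesis by linarith
qed

section \<open>Subsets as bit strings\<close>

definition bits :: "nat \<Rightarrow> nat set \<Rightarrow> bool list" where
  "bits m X = map (\<lambda>j. j \<in> X) [0..<m]"

lemma length_bits [simp]: "length (bits m X) = m"
  by (simp add: bits_def)

lemma nth_bits [simp]: "j < m \<Longrightarrow> bits m X ! j \<longleftrightarrow> j \<in> X"
  by (simp add: bits_def)

lemma count_list_True: "count_list ys True = card {i. i < length ys \<and> ys ! i}"
  by (simp add: count_list_eq_length_filter length_filter_conv_card)

lemma bij_betw_bits: "bij_betw (bits m) (Pow {..<m}) (cube m)"
  by (rule bij_betwI[where g = "\<lambda>ys. {i. i < m \<and> ys ! i}"])
     (auto simp: cube_def intro: nth_equalityI)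

lemma unif_cube_eq: "unif_cube m = map_pmf (bits m) (pmf_of_set (Pow {..<m}))"
  unfolding unif_cube_def
  by (rule map_pmf_of_set_bij_betw[OF bij_betw_bits, symmetric]) auto

lemma slice_dist_eq:
  assumes "k \<le> n"
  shows "slice_dist n k = map_pmf (bits n) (pmf_of_set {Y. Y \<subseteq> {..<n} \<and> card Y = k})"
  unfolding slice_dist_def
proof (rule map_pmf_of_set_bij_betw[symmetric])
  have count: "count_list (bits n Y) True = card Y" if "Y \<subseteq> {..<n}" for Y
  proof -
    have "{i. i < n \<and> bits n Y ! i} = Y" using that by auto
    then show ?thesis by (simp add: count_list_True)
  qed
  have "bits n ` {Y. Y \<subseteq> {..<n} \<and> card Y = k} = {ys \<in> bits n ` Pow {..<n}. count_list ys True = k}"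
    using count by auto
  then show "bij_betw (bits n) {Y. Y \<subseteq> {..<n} \<and> card Y = k} {ys \<in> cube n. count_list ys True = k}"
    using bij_betw_bits[of n] inj_on_subset[of "bits n" "Pow {..<n}" "{Y. Y \<subseteq> {..<n} \<and> card Y = k}"]
    unfolding bij_betw_def by auto
  show "{Y. Y \<subseteq> {..<n} \<and> card Y = k} \<noteq> {}"
    using assms by (auto intro!: exI[of _ "{..<k}"])
qed (auto intro: finite_subset[of _ "Pow {..<n}"])

lemma tvd_slice_ge:
  fixes \<theta> :: real
  assumes n: "0 < n" "0 < k" "2 * k \<le> n" and f: "d_local m n d f"
    and \<theta>: "100 \<le> log_star \<theta>" "60 * d \<le> log_star \<theta>" "2 * log_star (n / k) \<le> log_star \<theta>"
  shows "1 - \<theta> / sqrt n \<le> tvd (map_pmf f (unif_cube m)) (slice_dist n k)"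
proof -
  have len_f: "length (f (bits m X)) = n" for X
    using f by (auto simp: d_local_def cube_def)
  obtain N where N: "\<And>i. i < n \<Longrightarrow> N i \<subseteq> {..<m} \<and> card (N i) \<le> d \<and>
      (\<forall>x\<in>cube m. \<forall>y\<in>cube m. (\<forall>j\<in>N i. x ! j = y ! j) \<longrightarrow> f x ! i = f y ! i)"
    using f unfolding d_local_def by metis
  define F where "F X = {i. i < n \<and> f (bits m X) ! i}" for X
  interpret local_map "{..<n}" N d "{..<m}" F
  proof
    fix i X X' assume i: "i \<in> {..<n}" and eq: "X \<inter> N i = X' \<inter> N i"
    have "\<forall>j\<in>N i. bits m X ! j = bits m X' ! j"
    proof
      fix j assume "j \<in> N i"
      moreover from this have "j < m" using N[of i] i by auto
      ultimately show "bits m X ! j = bits m X' ! j" using eq by auto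
    qed
    then have "f (bits m X) ! i = f (bits m X') ! i"
      using N[of i] i by (simp add: cube_def)
    then show "i \<in> F X \<longleftrightarrow> i \<in> F X'" by (simp add: F_def)
  next
    fix i assume "i \<in> {..<n}"
    then show "finite (N i)" "card (N i) \<le> d"
      using N[of i] finite_subset[OF _ finite_lessThan] by blast+
  qed (auto simp: F_def)
  obtain Bad \<epsilon> \<delta> where Bad:
    "real (card {Y \<in> Pow {..<n}. card Y = k \<and> Y \<in> Bad}) \<le> real (n choose k) * \<epsilon>"
    "real (card {X \<in> Pow {..<m}. card (F X) = k \<and> F X \<notin> Bad}) \<le> 2 ^ card {..<m} * \<delta>"
    "\<epsilon> + \<delta> \<le> \<theta> / sqrt n"
  proof (rule exists_rare_outputs[of n k \<theta>])
    show "N i \<subseteq> {..<m}" if "i \<in> {..<n}" for i using N[of i] that by blast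
  qed (use n \<theta> in simp_all)
  define A where "A = {ys. count_list ys True = k \<longrightarrow> {i. i < n \<and> ys ! i} \<in> Bad}"
  let ?Sl = "{Y. Y \<subseteq> {..<n} \<and> card Y = k}"
  have "measure_pmf.prob (map_pmf f (unif_cube m)) (- A) \<le> \<delta>"
  proof -
    have "Pow {..<m} \<inter> (f \<circ> bits m) -` (- A) = {X \<in> Pow {..<m}. card (F X) = k \<and> F X \<notin> Bad}"
      by (auto simp: A_def F_def count_list_True len_f)
    then have "measure_pmf.prob (map_pmf f (unif_cube m)) (- A)
        = real (card {X \<in> Pow {..<m}. card (F X) = k \<and> F X \<notin> Bad}) / 2 ^ m"
      using measure_pmf_of_set[OF Pow_not_empty, of "{..<m}" "(f \<circ> bits m) -` (- A)"]
      by (simp add: unif_cube_eq vimage_comp measure_map_pmf card_Pow)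
    also have "\<dots> \<le> \<delta>" using Bad(2) by (simp add: divide_le_eq mult.commute)
    finally show ?thesis .
  qed
  moreover have "measure_pmf.prob (map_pmf f (unif_cube m)) (- A) = 1 - measure_pmf.prob (map_pmf f (unif_cube m)) A"
    using measure_pmf.prob_compl[of A "map_pmf f (unif_cube m)"] by (simp add: Compl_eq_Diff_UNIV)
  moreover have "measure_pmf.prob (slice_dist n k) A \<le> \<epsilon>"
  proof -
    have kn: "k \<le> n" using n by simp
    have sl: "finite ?Sl" "?Sl \<noteq> {}" "card ?Sl = n choose k"
      using n_subsets[of "{..<n}" k] kn by (auto intro!: exI[of _ "{..<k}"])
    have "{i. i < n \<and> bits n Y ! i} = Y" if "Y \<subseteq> {..<n}" for Y using that by auto
    then have "?Sl \<inter> bits n -` A = {Y \<in> Pow {..<n}. card Y = k \<and> Y \<in> Bad}"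
      by (auto simp: A_def count_list_True)
    then have "measure_pmf.prob (slice_dist n k) A
        = real (card {Y \<in> Pow {..<n}. card Y = k \<and> Y \<in> Bad}) / real (n choose k)"
      using sl by (simp add: slice_dist_eq[OF kn] measure_map_pmf measure_pmf_of_set)
    also have "\<dots> \<le> \<epsilon>" using Bad(1) kn by (simp add: divide_le_eq mult.commute)
    finally show ?thesis .
  qed
  ultimately have "1 - \<theta> / sqrt n \<le> measure_pmf.prob (map_pmf f (unif_cube m)) A
      - measure_pmf.prob (slice_dist n k) A"
    using Bad(3) by linarith
  also have "\<dots> \<le> tvd (map_pmf f (unif_cube m)) (slice_dist n k)" by (rule tvd_ge)
  finally show ?thesis .
qed

theorem mainTheorem7:
  shows "\<exists>\<kappa>::real. \<kappa> \<ge> 1 \<and>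
    (\<forall>(n::nat) (k::nat) (m::nat) (d::nat) (f :: bool list \<Rightarrow> bool list) (\<theta>::real).
      n \<ge> 2 \<longrightarrow> 1 \<le> k \<longrightarrow> real k \<le> real n / 2 \<longrightarrow>
      d_local m n d f \<longrightarrow> \<theta> > 0 \<longrightarrow> \<theta> \<ge> \<kappa> \<longrightarrow>
      real d \<le> real (log_star \<theta>) / 60 \<longrightarrow>
      real (log_star (real n / real k)) \<le> real (log_star \<theta>) / 2 \<longrightarrow>
      tvd (map_pmf f (unif_cube m)) (slice_dist n k) \<ge> 1 - \<theta> / sqrt (real n))"
proof (intro exI[of _ "real (tow2 99) + 1"] conjI allI impI)
  show "1 \<le> real (tow2 99) + 1" by simp
  fix n k m d :: nat and f :: "bool list \<Rightarrow> bool list" and \<theta> :: real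
  assume n: "2 \<le> n" "1 \<le> k" "real k \<le> real n / 2" and f: "d_local m n d f"
    and \<theta>: "real (tow2 99) + 1 \<le> \<theta>" "real d \<le> real (log_star \<theta>) / 60"
      "real (log_star (real n / real k)) \<le> real (log_star \<theta>) / 2"
  \<comment> \<open>The summand 1 in \<kappa> makes \<theta> strictly larger than
    \<open>tow2 99\<close>. The height 100 is a generous choice: it leaves room for the starting
    level and for the constant 3 in h + 4 d + 3.\<close>
  have "99 < log_star \<theta>" by (rule less_log_star) (use \<theta>(1) in linarith)
  then have "100 \<le> log_star \<theta>" by linarith
  moreover have "60 * d \<le> log_star \<theta>" using \<theta>(2) by linarith
  moreover have "2 * log_star (real n / real k) \<le> log_star \<theta>" using \<theta>(3) by linarith
  moreover have "0 < n" "0 < k" "2 * k \<le> n" using n by linarith+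
  ultimately show "1 - \<theta> / sqrt (real n) \<le> tvd (map_pmf f (unif_cube m)) (slice_dist n k)"
    using tvd_slice_ge f by blast
qed

end
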